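(* Consider the adaptive experiment described in the context, with $Y_t\in[0,1]$ for all $t$ and propensity scores truncated so that $\pi_t(a\mid X_t,\Omega_{t-1})\in\left[\frac{1}{k_t},1-\frac{1}{k_t}\right]$, $k_t\ge2$. Fix $\alpha\in(0,1)$ and $\sigma_0^2>0$. Define $$\xi_t = \frac{h_t}{k_t + 1},\quad \hat{\xi}_{t-1} = \left(\frac{1}{t-1} \sum_{i=1}^{t-1} \xi_i \right) \wedge \frac{1}{k_t + 1},\quad \psi_E(\lambda) = - \log(1- \lambda) - \lambda,$$ $$\bar{\xi}_t = \left(\frac{1}{t} \sum_{i = 1}^{t} \xi_i\right) \wedge \frac{1}{k_t + 1},\quad \hat{\sigma}^2_t = \frac{\sigma^2_0 + \sum_{i = 1}^t (\xi_i - \bar{\xi}_i)^2}{t+1},\quad \lambda_t = \sqrt{\frac{2 \log (2/ \alpha)}{\hat{\sigma}^2_{t-1}\, t \log(1 + t)}} \wedge \frac12 .$$ Then the intervals $$C_T^{PrPI-EB} = \frac{\sum_{t=1}^T \lambda_t \xi_t}{\sum_{t=1}^T \lambda_t/(k_t + 1)} \pm \frac{\log(2/\alpha) + \sum_{t=1}^T \left(\xi_t - \hat{\xi}_{t-1} \right)^2 \psi_{E}(\lambda_t)}{\sum_{t=1}^T \lambda_t / (k_t + 1)},\qquad T\ge1,$$ form a $(1-\alpha)$-confidence sequence for $\theta_0$, i.e. $\mathbb{P}(\forall T\ge1:\ \theta_0\in C_T^{PrPI-EB})\ge 1-\alpha$.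
   Context: Data-generating process: subjects $t=1,2,\dots$ arrive sequentially. The tuples $(X_t, Y_t(0), Y_t(1))$ are i.i.d. over $t$. Let $\Omega_{t-1}=\{(X_s,A_s,Y_s): s\le t-1\}$ be the history. Given $X_t$ and $\Omega_{t-1}$, the treatment $A_t\in\{0,1\}$ is drawn with $\mathbb{P}(A_t=1\mid X_t,\Omega_{t-1})=\pi_t(1\mid X_t,\Omega_{t-1})$ (and $\pi_t(0\mid\cdot)=1-\pi_t(1\mid\cdot)$), independently of the current potential outcomes; the observed outcome is $Y_t = \mathbb{1}[A_t=0]Y_t(0)+\mathbb{1}[A_t=1]Y_t(1)$. $\theta_0=\mathbb{E}[Y(1)-Y(0)]$. $\hat f_t(a,x)$ is an estimator of $\mathbb{E}[Y(a)\mid X=x]$ constructed from $\Omega_t$, and $$h_t=\frac{\mathbb{1}[A_t=1](Y_t-\hat f_{t-1}(1,X_t))}{\pi_t(1\mid X_t,\Omega_{t-1})}-\frac{\mathbb{1}[A_t=0](Y_t-\hat f_{t-1}(0,X_t))}{\pi_t(0\mid X_t,\Omega_{t-1})}+\hat f_{t-1}(1,X_t)-\hat f_{t-1}(0,X_t).$$ $k_t$ is a user-chosen truncation parameter.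
   Formalization: The estimators f̂_t(a,x) are assumed to take values in [0,1]; without a bound the claim fails (e.g. Y=0, π_t(1)=1/k, f̂(1,·)=k+1, f̂(0,·)=0, k large). Sequential arrival is read as: the tuple at time t is independent of Ω_{t-1}; both potential outcomes lie in [0,1]. *)

theory Defs
  imports "HOL-Probability.Probability"
begin

definition pre_sets :: "'a measure \<Rightarrow> 'b measure \<Rightarrow> ('a \<Rightarrow> 'b) \<Rightarrow> 'a set set" where
  "pre_sets M N f = {f -` B \<inter> space M | B. B \<in> sets N}"

definition Yobs :: "(nat \<Rightarrow> 'a \<Rightarrow> bool) \<Rightarrow> (nat \<Rightarrow> 'a \<Rightarrow> real) \<Rightarrow> (nat \<Rightarrow> 'a \<Rightarrow> real)
    \<Rightarrow> nat \<Rightarrow> 'a \<Rightarrow> real" where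
  "Yobs A Y0 Y1 t \<omega> = (if A t \<omega> then Y1 t \<omega> else Y0 t \<omega>)"

definition hist :: "'a measure \<Rightarrow> 'x measure \<Rightarrow> (nat \<Rightarrow> 'a \<Rightarrow> 'x) \<Rightarrow> (nat \<Rightarrow> 'a \<Rightarrow> bool)
    \<Rightarrow> (nat \<Rightarrow> 'a \<Rightarrow> real) \<Rightarrow> (nat \<Rightarrow> 'a \<Rightarrow> real) \<Rightarrow> nat \<Rightarrow> 'a measure" where
  "hist M Mx X A Y0 Y1 t = sigma (space M)
     (\<Union>s\<in>{1..<t}. pre_sets M Mx (X s) \<union> pre_sets M (count_space UNIV) (A s)
                    \<union> pre_sets M borel (Yobs A Y0 Y1 s))"

definition histX :: "'a measure \<Rightarrow> 'x measure \<Rightarrow> (nat \<Rightarrow> 'a \<Rightarrow> 'x) \<Rightarrow> (nat \<Rightarrow> 'a \<Rightarrow> bool)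
    \<Rightarrow> (nat \<Rightarrow> 'a \<Rightarrow> real) \<Rightarrow> (nat \<Rightarrow> 'a \<Rightarrow> real) \<Rightarrow> nat \<Rightarrow> 'a measure" where
  "histX M Mx X A Y0 Y1 t = sigma (space M)
     (pre_sets M Mx (X t) \<union> sets (hist M Mx X A Y0 Y1 t))"

definition histXY :: "'a measure \<Rightarrow> 'x measure \<Rightarrow> (nat \<Rightarrow> 'a \<Rightarrow> 'x) \<Rightarrow> (nat \<Rightarrow> 'a \<Rightarrow> bool)
    \<Rightarrow> (nat \<Rightarrow> 'a \<Rightarrow> real) \<Rightarrow> (nat \<Rightarrow> 'a \<Rightarrow> real) \<Rightarrow> nat \<Rightarrow> 'a measure" where
  "histXY M Mx X A Y0 Y1 t = sigma (space M)
     (pre_sets M Mx (X t) \<union> pre_sets M borel (Y0 t) \<union> pre_sets M borel (Y1 t)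
      \<union> sets (hist M Mx X A Y0 Y1 t))"

text \<open>fhat t a x \<omega> is fhat_t(a,x) (built from Omega_t); p t \<omega> = pi_t(1 | X_t, Omega_{t-1}).\<close>
definition hseq :: "(nat \<Rightarrow> 'a \<Rightarrow> 'x) \<Rightarrow> (nat \<Rightarrow> 'a \<Rightarrow> bool) \<Rightarrow> (nat \<Rightarrow> 'a \<Rightarrow> real)
    \<Rightarrow> (nat \<Rightarrow> 'a \<Rightarrow> real) \<Rightarrow> (nat \<Rightarrow> 'a \<Rightarrow> real) \<Rightarrow> (nat \<Rightarrow> bool \<Rightarrow> 'x \<Rightarrow> 'a \<Rightarrow> real)
    \<Rightarrow> nat \<Rightarrow> 'a \<Rightarrow> real" where
  "hseq X A Y0 Y1 p fhat t \<omega> =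
     (if A t \<omega> then (Yobs A Y0 Y1 t \<omega> - fhat (t - 1) True (X t \<omega>) \<omega>) / p t \<omega> else 0)
   - (if \<not> A t \<omega> then (Yobs A Y0 Y1 t \<omega> - fhat (t - 1) False (X t \<omega>) \<omega>) / (1 - p t \<omega>) else 0)
   + fhat (t - 1) True (X t \<omega>) \<omega> - fhat (t - 1) False (X t \<omega>) \<omega>"

definition psiE :: "real \<Rightarrow> real" where
  "psiE l = - ln (1 - l) - l"

definition xi :: "(nat \<Rightarrow> real) \<Rightarrow> (nat \<Rightarrow> real) \<Rightarrow> nat \<Rightarrow> real" where
  "xi k h t = h t / (k t + 1)"

text \<open>xihat k h t is xihat_{t-1} (empty mean = 0 for t = 1).\<close>
definition xihat :: "(nat \<Rightarrow> real) \<Rightarrow> (nat \<Rightarrow> real) \<Rightarrow> nat \<Rightarrow> real" where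
  "xihat k h t = min ((\<Sum>i=1..<t. xi k h i) / real (t - 1)) (1 / (k t + 1))"

definition xibar :: "(nat \<Rightarrow> real) \<Rightarrow> (nat \<Rightarrow> real) \<Rightarrow> nat \<Rightarrow> real" where
  "xibar k h t = min ((\<Sum>i=1..t. xi k h i) / real t) (1 / (k t + 1))"

definition sighat2 :: "real \<Rightarrow> (nat \<Rightarrow> real) \<Rightarrow> (nat \<Rightarrow> real) \<Rightarrow> nat \<Rightarrow> real" where
  "sighat2 s0 k h t = (s0 + (\<Sum>i=1..t. (xi k h i - xibar k h i)\<^sup>2)) / (real t + 1)"

definition lam :: "real \<Rightarrow> real \<Rightarrow> (nat \<Rightarrow> real) \<Rightarrow> (nat \<Rightarrow> real) \<Rightarrow> nat \<Rightarrow> real" where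
  "lam \<alpha> s0 k h t = min (sqrt (2 * ln (2 / \<alpha>) /
       (sighat2 s0 k h (t - 1) * real t * ln (1 + real t)))) (1 / 2)"

definition cs_center :: "real \<Rightarrow> real \<Rightarrow> (nat \<Rightarrow> real) \<Rightarrow> (nat \<Rightarrow> real) \<Rightarrow> nat \<Rightarrow> real" where
  "cs_center \<alpha> s0 k h T =
     (\<Sum>t=1..T. lam \<alpha> s0 k h t * xi k h t) / (\<Sum>t=1..T. lam \<alpha> s0 k h t / (k t + 1))"

definition cs_radius :: "real \<Rightarrow> real \<Rightarrow> (nat \<Rightarrow> real) \<Rightarrow> (nat \<Rightarrow> real) \<Rightarrow> nat \<Rightarrow> real" where
  "cs_radius \<alpha> s0 k h T =
     (ln (2 / \<alpha>) + (\<Sum>t=1..T. (xi k h t - xihat k h t)\<^sup>2 * psiE (lam \<alpha> s0 k h t)))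
     / (\<Sum>t=1..T. lam \<alpha> s0 k h t / (k t + 1))"

definition CS_PrPI_EB :: "real \<Rightarrow> real \<Rightarrow> (nat \<Rightarrow> real) \<Rightarrow> (nat \<Rightarrow> real) \<Rightarrow> nat \<Rightarrow> real set" where
  "CS_PrPI_EB \<alpha> s0 k h T =
     {cs_center \<alpha> s0 k h T - cs_radius \<alpha> s0 k h T .. cs_center \<alpha> s0 k h T + cs_radius \<alpha> s0 k h T}"

end

theory Submission
  imports Defs
begin

text \<open>
  Given the history, $\xi_t$ has mean $\mu_t = \theta_0/(k_t+1)$ and $|\xi_t - \mu_t| \le 1$.
  For either sign $s$, the product of the factors
  $\exp(s\lambda_t(\xi_t - \mu_t) - \psi_E(\lambda_t)(\xi_t - \hat\xi_{t-1})^2)$ is a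
  nonnegative supermartingale started at 1, so by Ville's inequality it ever reaches $2/\alpha$ with
  probability at most $\alpha/2$; outside these two events all intervals contain $\theta_0$.

  Each factor is dominated by $1 + b\,s(\xi_t - \mu_t)$ with a predictable slope $b$. When
  $s(\xi_t - \hat\xi_{t-1}) \ge -1$ this is the usual bound
  $\exp(\lambda y - \psi_E(\lambda) y^2) \le 1 + \lambda y$. For $s = -1$ the condition can fail,
  because $\hat\xi_{t-1}$ is truncated only from above; but it fails only if
  $s(\hat\xi_{t-1} - \mu_t) > 0$, and this error of $\hat\xi_{t-1}$ then enlarges the quadratic
  penalty enough to restore a linear bound, as long as $\lambda \le 1/2$.
\<close>

subsection \<open>Linear bounds for the exponential factors\<close>

lemma psiE_nonneg:
  assumes "0 \<le> l" "l < 1"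
  shows "0 \<le> psiE l"
  using ln_le_minus_one[of "1 - l"] assms by (simp add: psiE_def)

lemma DERIV_psiE:
  assumes "l < 1"
  shows "(psiE has_real_derivative l / (1 - l)) (at l)"
proof -
  have "((\<lambda>l. - ln (1 - l) - l) has_real_derivative l / (1 - l)) (at l)"
    using assms by (auto intro!: derivative_eq_intros simp: field_simps)
  then show ?thesis
    by (simp add: psiE_def[abs_def])
qed

text \<open>Fan's inequality. In logarithmic form both sides agree at \<open>l = 0\<close>, and the
  derivative in \<open>l\<close> of their difference is a nonnegative multiple of
  \<open>1 / (1 - m) - 1 / (1 + m * y)\<close>, which is nonnegative because
  \<open>y \<ge> -1\<close>.\<close>

lemma exp_le_one_plus:
  assumes l: "0 \<le> l" "l < 1" and y: "-1 \<le> y"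
  shows "exp (l * y - psiE l * y\<^sup>2) \<le> 1 + l * y"
proof -
  have pos: "0 < 1 + m * y" if "0 \<le> m" "m \<le> l" for m
  proof -
    have "m * (-1) \<le> m * y" using that y by (intro mult_left_mono) auto
    then show ?thesis using that l by simp
  qed
  define g where "g m = ln (1 + m * y) - m * y + psiE m * y\<^sup>2" for m
  have "g 0 \<le> g l"
  proof (rule DERIV_nonneg_imp_nondecreasing[OF l(1)])
    fix m assume m: "0 \<le> m" "m \<le> l"
    have m1: "m < 1" using m l by simp
    let ?D = "y / (1 + m * y) - y + m / (1 - m) * y\<^sup>2"
    have "(g has_real_derivative ?D) (at m)"
      unfolding g_def using pos[OF m]
      by (auto intro!: derivative_eq_intros DERIV_psiE m1 simp: field_simps)
    moreover have "?D = m * y\<^sup>2 * (1 / (1 - m) - 1 / (1 + m * y))"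
      using pos[OF m] m1 by (simp add: field_simps power2_eq_square)
    moreover have "1 / (1 + m * y) \<le> 1 / (1 - m)"
    proof (rule divide_left_mono)
      show "1 - m \<le> 1 + m * y" using mult_left_mono[OF y m(1)] by simp
    qed (use pos[OF m] m1 in auto)
    ultimately show "\<exists>D. (g has_real_derivative D) (at m) \<and> 0 \<le> D"
      using m(1) by (intro exI[of _ ?D]) auto
  qed
  then have "l * y - psiE l * y\<^sup>2 \<le> ln (1 + l * y)"
    by (simp add: g_def psiE_def)
  then show ?thesis
    using pos[of l] l by (simp add: ln_ge_iff)
qed

text \<open>The left side is the sum of the first three terms of the series
  \<open>l^2/2 + l^3/3 + ...\<close> of \<open>psiE\<close>; the derivative of the remainder is the
  geometric tail \<open>m^4 / (1 - m)\<close>.\<close>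

lemma psiE_ge:
  assumes "0 \<le> l" "l < 1"
  shows "l\<^sup>2 * (1/2 + l/3 + l\<^sup>2/4) \<le> psiE l"
proof -
  define g where "g m = psiE m - (m^2 / 2 + m^3 / 3 + m^4 / 4)" for m
  have "g 0 \<le> g l"
  proof (rule DERIV_nonneg_imp_nondecreasing[OF assms(1)])
    fix m assume m: "0 \<le> m" "m \<le> l"
    have m1: "m < 1" using m assms by simp
    let ?D = "m / (1 - m) - (m + m^2 + m^3)"
    have "(g has_real_derivative ?D) (at m)"
      unfolding g_def by (auto intro!: derivative_eq_intros DERIV_psiE m1)
    moreover have "?D = m^4 / (1 - m)"
      using m1 by (simp add: field_simps power_numeral_reduce)
    ultimately show "\<exists>D. (g has_real_derivative D) (at m) \<and> 0 \<le> D"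
      using m(1) m1 by (intro exI[of _ ?D]) auto
  qed
  then show ?thesis
    by (simp add: g_def psiE_def algebra_simps power_numeral_reduce)
qed

text \<open>\<open>psiE\<close> increases up to \<open>ln 2 - 1/2\<close>, about 0.193, at
  \<open>l = 1/2\<close>. The constant 2/9 is made for \<open>exp_le_linear_neg\<close>, where it
  meets the factor 9.\<close>

lemma psiE_le:
  assumes "0 \<le> l" "l \<le> 1/2"
  shows "psiE l \<le> 2/9"
proof -
  have "psiE l \<le> psiE (1/2)"
  proof (rule DERIV_nonneg_imp_nondecreasing[OF assms(2)])
    fix m assume m: "l \<le> m" "m \<le> 1/2"
    show "\<exists>D. (psiE has_real_derivative D) (at m) \<and> 0 \<le> D"
      using DERIV_psiE[of m] m assms by (intro exI[of _ "m / (1 - m)"]) auto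
  qed
  also have "\<dots> = ln 2 - 1/2" by (simp add: psiE_def ln_div)
  also have "\<dots> \<le> 2/9" using ln2_le_25_over_36 by simp
  finally show ?thesis .
qed

lemma exp_minus_le_quadratic:
  assumes "0 \<le> (q::real)"
  shows "exp (- q) \<le> 1 - q + q\<^sup>2 / 2"
proof -
  define g where "g x = 1 - x + x\<^sup>2 / 2 - exp (- x)" for x :: real
  have "g 0 \<le> g q"
  proof (rule DERIV_nonneg_imp_nondecreasing[OF assms])
    fix m :: real
    have "(g has_real_derivative (m - 1 + exp (- m))) (at m)"
      unfolding g_def by (auto intro!: derivative_eq_intros)
    then show "\<exists>D. (g has_real_derivative D) (at m) \<and> 0 \<le> D"
      using exp_ge_add_one_self[of "- m"] by (intro exI[of _ "m - 1 + exp (- m)"]) auto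
  qed
  then show ?thesis by (simp add: g_def)
qed

text \<open>Raising the Taylor coefficient 1/6 to 1/5 pays for all higher terms as long as
  \<open>v \<le> 1/2\<close>: after multiplication by \<open>exp (- x)\<close> the derivative
  carries the factor \<open>1/10 - m/5\<close>, which changes sign at 1/2.\<close>

lemma exp_le_cubic:
  assumes "0 \<le> (v::real)" "v \<le> 1/2"
  shows "exp v \<le> 1 + v + v\<^sup>2 / 2 + v^3 / 5"
proof -
  define g where "g x = (1 + x + x\<^sup>2 / 2 + x^3 / 5) * exp (- x)" for x :: real
  have "g 0 \<le> g v"
  proof (rule DERIV_nonneg_imp_nondecreasing[OF assms(1)])
    fix m :: real assume m: "0 \<le> m" "m \<le> v"
    let ?D = "m\<^sup>2 * (1/10 - m/5) * exp (- m)"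
    have "(g has_real_derivative ?D) (at m)"
      unfolding g_def by (auto intro!: derivative_eq_intros simp: field_simps power_numeral_reduce)
    then show "\<exists>D. (g has_real_derivative D) (at m) \<and> 0 \<le> D"
      using m assms by (intro exI[of _ ?D]) auto
  qed
  then show ?thesis by (simp add: g_def exp_minus field_simps)
qed

text \<open>
  For \<open>d > 0\<close>, the linear bound \<open>1 + b y\<close> of \<open>exp_le_linear\<close> below at \<open>y = -1\<close> forces, to first order in
  \<open>d\<close>, \<open>b \<le> l + 2 \<psi>(l) (1 - l) d\<close>; this extreme value works. The cap at 1 is harmless since
  replacing \<open>d > 1\<close> by 1 only increases the left-hand side when \<open>\<bar>y\<bar> \<le> 1\<close>.
\<close>
definition tangent_slope :: "real \<Rightarrow> real \<Rightarrow> real" where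
  "tangent_slope l d = (if d \<le> 0 then l * exp (l * d) else l + 2 * psiE l * (1 - l) * min d 1)"

lemma tangent_slope_bounds:
  assumes l: "0 \<le> l" "l \<le> 1/2"
  shows "0 \<le> tangent_slope l d" "tangent_slope l d \<le> 1"
proof -
  have psi: "0 \<le> psiE l" "psiE l \<le> 2/9"
    using psiE_nonneg[of l] psiE_le[of l] l by auto
  show "0 \<le> tangent_slope l d" using l psi by (auto simp: tangent_slope_def min_def)
  show "tangent_slope l d \<le> 1"
  proof (cases "d \<le> 0")
    case True
    then have "exp (l * d) \<le> 1" using l by (simp add: mult_nonneg_nonpos)
    then have "l * exp (l * d) \<le> (1/2) * 1" using l by (intro mult_mono) auto
    then show ?thesis using True by (simp add: tangent_slope_def)
  next
    case False
    have "psiE l * ((1 - l) * min d 1) \<le> 2/9 * (1 * 1)"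
      using psi l False by (intro mult_mono mult_nonneg_nonneg) auto
    then show ?thesis using False l by (simp add: tangent_slope_def)
  qed
qed

text \<open>The side \<open>y = -z\<close>. With \<open>d = 0\<close> this is
  \<open>exp_le_one_plus\<close>; the error \<open>d\<close> adds \<open>q\<close> to the penalty,
  and the factor \<open>exp (- q)\<close> steepens the line to the stated slope.\<close>

lemma exp_le_linear_neg:
  assumes l: "0 \<le> l" "l \<le> 1/2" and d: "0 \<le> d" "d \<le> 1" and z: "0 \<le> z" "z \<le> 1"
  shows "exp (- l * z - psiE l * (z + d)\<^sup>2) \<le> 1 - (l + 2 * psiE l * (1 - l) * d) * z"
proof -
  have psi: "0 \<le> psiE l" "psiE l \<le> 2/9"
    using psiE_nonneg[of l] psiE_le[of l] l by auto
  define q where "q = psiE l * d * (2 * z + d)"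
  have q: "0 \<le> q" using psi d z by (simp add: q_def)
  have lz: "1 - l \<le> 1 - l * z" "0 \<le> 1 - l" using l z mult_left_mono[of z 1 l] by auto
  have "exp (l * (- z) - psiE l * (- z)\<^sup>2) \<le> 1 + l * (- z)"
    using l z by (intro exp_le_one_plus) auto
  then have base: "exp (- l * z - psiE l * z\<^sup>2) \<le> 1 - l * z" by simp
  have "exp (- l * z - psiE l * (z + d)\<^sup>2) = exp (- l * z - psiE l * z\<^sup>2) * exp (- q)"
    by (simp add: q_def algebra_simps power2_eq_square flip: exp_add)
  also have "\<dots> \<le> (1 - l * z) * exp (- q)"
    using base by (intro mult_right_mono) auto
  also have "\<dots> \<le> (1 - l * z) * (1 - 2 * psiE l * d * z)"
  proof (intro mult_left_mono)
    \<comment> \<open>As \<open>2 * z + d\<close> is at most 3 and \<open>psiE l\<close> at most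
      2/9, the second-order term \<open>q\<^sup>2 / 2\<close> is absorbed by the part
      \<open>psiE l * d\<^sup>2\<close> of \<open>q\<close>, which leaves the part linear in
      \<open>z\<close>.\<close>
    have "(2 * z + d)\<^sup>2 \<le> 3\<^sup>2" using z d by (intro power_mono) auto
    then have "psiE l * (2 * z + d)\<^sup>2 \<le> 2/9 * 3\<^sup>2" using psi by (intro mult_mono) auto
    then have "(psiE l * (2 * z + d)\<^sup>2) * (psiE l * d\<^sup>2) \<le> 2 * (psiE l * d\<^sup>2)"
      using psi by (intro mult_right_mono) auto
    then have "q\<^sup>2 / 2 \<le> psiE l * d\<^sup>2" by (simp add: q_def power2_eq_square algebra_simps)
    moreover have "q = psiE l * d\<^sup>2 + 2 * psiE l * d * z"
      by (simp add: q_def power2_eq_square algebra_simps)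
    ultimately show "exp (- q) \<le> 1 - 2 * psiE l * d * z"
      using exp_minus_le_quadratic[OF q] by linarith
  qed (use lz in auto)
  \<comment> \<open>In the cross term \<open>1 - l * z\<close> is replaced by its value
    \<open>1 - l\<close> at \<open>z = 1\<close>; this makes the bound linear in \<open>z\<close>
    and yields the factor \<open>1 - l\<close> of the slope.\<close>
  also have "\<dots> \<le> 1 - l * z - (1 - l) * (2 * psiE l * d * z)"
    using mult_right_mono[OF lz(1), of "2 * psiE l * d * z"] psi d z by (simp add: algebra_simps)
  finally show ?thesis by (simp add: algebra_simps)
qed

text \<open>What \<open>exp_le_linear_pos\<close> reduces to once \<open>exp\<close> is replaced by
  its cubic majorant and \<open>psiE\<close> by the first terms of its series. The quadratic forms
  \<open>Q0\<close> and \<open>Q1\<close> are bounded separately, by completing the square in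
  \<open>d\<close>.\<close>

lemma quadratic_bound:
  fixes l d z :: real
  assumes l: "0 \<le> l" "l \<le> 1/2" and z: "0 \<le> z" "z \<le> 1"
  shows "z\<^sup>2 / 2 + l * z^3 / 5 \<le>
    (1/2 + l/3 + l\<^sup>2/4) * (2 * d * (1 - l) * z + (d - z)\<^sup>2 * (1 + l * z))"
proof -
  define r where "r = 1/2 + l/3 + l\<^sup>2/4"
  \<comment> \<open>the last factor on the right is the convex combination \<open>(1 - z) Q0 + z Q1\<close>\<close>
  define Q0 where "Q0 = d\<^sup>2 + z\<^sup>2 - 2 * l * d * z"
  define Q1 where "Q1 = Q0 + l * (d - z)\<^sup>2"
  have r: "0 \<le> r" using l by (simp add: r_def)
  \<comment> \<open>On [0, 1/2] the higher powers of \<open>l\<close> are dominated by multiples of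
    \<open>l\<close>, which makes the two polynomial comparisons below linear in
    \<open>l\<close>.\<close>
  have l2: "l\<^sup>2 \<le> l / 2" using l mult_right_mono[of l "1/2" l] by (simp add: power2_eq_square)
  have l3: "l^3 \<le> l / 4" using l l2 mult_right_mono[of "l" "1/2" "l\<^sup>2"]
    by (simp add: power_numeral_reduce)
  have l4: "l^4 \<le> l / 8" using l l3 mult_right_mono[of "l" "1/2" "l^3"]
    by (simp add: power_numeral_reduce)
  have "Q0 = (d - l * z)\<^sup>2 + (1 - l\<^sup>2) * z\<^sup>2"
    by (simp add: Q0_def power2_eq_square algebra_simps)
  then have "(1 - l\<^sup>2) * z\<^sup>2 \<le> Q0" by simp
  then have "r * ((1 - l\<^sup>2) * z\<^sup>2) \<le> r * Q0" using r by (rule mult_left_mono)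
  moreover have "r * (1 - l\<^sup>2) = 1/2 + l/3 - l\<^sup>2/4 - l^3/3 - l^4/4"
    by (simp add: r_def field_simps power_numeral_reduce)
  then have "1/2 \<le> r * (1 - l\<^sup>2)"
    using l2 l3 l4 l by linarith
  then have "1/2 * z\<^sup>2 \<le> r * (1 - l\<^sup>2) * z\<^sup>2" by (intro mult_right_mono) auto
  ultimately have Q0: "z\<^sup>2 / 2 \<le> r * Q0" by (simp add: mult.assoc)
  \<comment> \<open>The coefficient of \<open>d\<^sup>2\<close> in \<open>Q1\<close> is
    \<open>1 + l\<close>; multiplying by it first completes the square without fractions.\<close>
  have "(1 + l) * Q1 = ((1 + l) * d - 2 * l * z)\<^sup>2 + ((1 + l)\<^sup>2 - 4 * l\<^sup>2) * z\<^sup>2"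
    by (simp add: Q1_def Q0_def power2_eq_square algebra_simps)
  then have "((1 + l)\<^sup>2 - 4 * l\<^sup>2) * z\<^sup>2 \<le> (1 + l) * Q1" by simp
  then have "r * (((1 + l)\<^sup>2 - 4 * l\<^sup>2) * z\<^sup>2) \<le> r * ((1 + l) * Q1)"
    using r by (rule mult_left_mono)
  moreover have "r * ((1 + l)\<^sup>2 - 4 * l\<^sup>2) - (1/2 + l/5) * (1 + l)
      = 19/30 * l - 47/60 * l\<^sup>2 - 1/2 * l^3 - 3/4 * l^4"
    by (simp add: r_def field_simps power_numeral_reduce)
  then have "(1/2 + l/5) * (1 + l) \<le> r * ((1 + l)\<^sup>2 - 4 * l\<^sup>2)"
    using l2 l3 l4 l by linarith
  then have "(1/2 + l/5) * (1 + l) * z\<^sup>2 \<le> r * ((1 + l)\<^sup>2 - 4 * l\<^sup>2) * z\<^sup>2"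
    by (intro mult_right_mono) auto
  ultimately have "(1 + l) * ((1/2 + l/5) * z\<^sup>2) \<le> (1 + l) * (r * Q1)"
    by (simp add: algebra_simps)
  then have Q1: "(1/2 + l/5) * z\<^sup>2 \<le> r * Q1" using l by simp
  have "(1 - z) * (z\<^sup>2 / 2) + z * ((1/2 + l/5) * z\<^sup>2) \<le> (1 - z) * (r * Q0) + z * (r * Q1)"
    using Q0 Q1 z by (intro add_mono mult_left_mono) auto
  moreover have "(1 - z) * (r * Q0) + z * (r * Q1) =
      r * (2 * d * (1 - l) * z + (d - z)\<^sup>2 * (1 + l * z))"
    by (simp add: Q1_def Q0_def power2_eq_square algebra_simps)
  moreover have "(1 - z) * (z\<^sup>2 / 2) + z * ((1/2 + l/5) * z\<^sup>2) = z\<^sup>2 / 2 + l * z^3 / 5"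
    by (simp add: field_simps power_numeral_reduce)
  ultimately show ?thesis by (simp add: r_def)
qed

text \<open>The side \<open>y = z\<close>. The penalty \<open>w\<close> is moved to the right, where
  \<open>exp w \<ge> 1 + w\<close>; what remains is a comparison of polynomials, settled by
  \<open>quadratic_bound\<close>.\<close>

lemma exp_le_linear_pos:
  assumes l: "0 \<le> l" "l \<le> 1/2" and d: "0 \<le> d" and z: "0 \<le> z" "z \<le> 1"
  shows "exp (l * z - psiE l * (z - d)\<^sup>2) \<le> 1 + (l + 2 * psiE l * (1 - l) * d) * z"
proof -
  have psi: "0 \<le> psiE l" using psiE_nonneg[of l] l by auto
  define w where "w = psiE l * (d - z)\<^sup>2"
  \<comment> \<open>\<open>psiE l * B\<close> is the excess of
    \<open>(1 + l * z) * (1 + w) + 2 * psiE l * (1 - l) * d * z\<close> over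
    \<open>1 + l * z\<close>.\<close>
  define B where "B = 2 * d * (1 - l) * z + (d - z)\<^sup>2 * (1 + l * z)"
  have w: "0 \<le> w" using psi by (simp add: w_def)
  have B: "0 \<le> B" using l d z by (simp add: B_def)
  have "l * z \<le> 1/2 * 1" using l z by (intro mult_mono) auto
  then have "exp (l * z) \<le> 1 + l * z + (l * z)\<^sup>2 / 2 + (l * z)^3 / 5"
    using l z by (intro exp_le_cubic) auto
  also have "\<dots> = 1 + l * z + l\<^sup>2 * (z\<^sup>2 / 2 + l * z^3 / 5)"
    by (simp add: power_numeral_reduce algebra_simps)
  also have "\<dots> \<le> 1 + l * z + l\<^sup>2 * ((1/2 + l/3 + l\<^sup>2/4) * B)"
    unfolding B_def by (intro add_left_mono mult_left_mono quadratic_bound l z) auto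
  also have "\<dots> = 1 + l * z + (l\<^sup>2 * (1/2 + l/3 + l\<^sup>2/4)) * B" by simp
  also have "\<dots> \<le> 1 + l * z + psiE l * B"
    using l B by (intro add_left_mono mult_right_mono psiE_ge) auto
  also have "\<dots> = (1 + l * z) * (1 + w) + 2 * psiE l * (1 - l) * d * z"
    by (simp add: w_def B_def algebra_simps)
  also have "\<dots> \<le> (1 + (l + 2 * psiE l * (1 - l) * d) * z) * (1 + w)"
  proof -
    have "0 \<le> 2 * psiE l * (1 - l) * d * z * w" using psi l d z w by simp
    then show ?thesis by (simp add: algebra_simps)
  qed
  also have "\<dots> \<le> (1 + (l + 2 * psiE l * (1 - l) * d) * z) * exp w"
    using psi l d z exp_ge_add_one_self[of w] by (intro mult_left_mono) auto
  finally have "exp (l * z) \<le> (1 + (l + 2 * psiE l * (1 - l) * d) * z) * exp w" .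
  then have "exp (l * z) / exp w \<le> 1 + (l + 2 * psiE l * (1 - l) * d) * z"
    by (simp add: divide_le_eq)
  moreover have "l * z - psiE l * (z - d)\<^sup>2 = l * z - w"
    by (simp add: w_def power2_commute)
  ultimately show ?thesis by (simp add: exp_diff)
qed

text \<open>In the application \<open>y\<close> is the signed deviation of \<open>xi\<close> from
  its mean and \<open>d\<close> that of the predictor \<open>xihat\<close>. The slope depends on
  \<open>l\<close> and \<open>d\<close> alone, so it is known before the round and the linear term
  averages to zero.\<close>

lemma exp_le_linear:
  assumes l: "0 \<le> l" "l \<le> 1/2" and y: "\<bar>y\<bar> \<le> 1"
  shows "exp (l * y - psiE l * (y - d)\<^sup>2) \<le> 1 + tangent_slope l d * y"
proof (cases "d \<le> 0")
  case True
  \<comment> \<open>For \<open>d \<le> 0\<close> the shifted value \<open>y - d\<close> is at least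
    -1, so \<open>exp_le_one_plus\<close> applies to it; the factor \<open>exp (l * d)\<close>
    brings the constant term \<open>1 - l * d\<close> back to at most 1.\<close>
  have "exp (l * y - psiE l * (y - d)\<^sup>2) = exp (l * (y - d) - psiE l * (y - d)\<^sup>2) * exp (l * d)"
    by (simp add: algebra_simps flip: exp_add)
  also have "\<dots> \<le> (1 + l * (y - d)) * exp (l * d)"
    using l y True by (intro mult_right_mono exp_le_one_plus) auto
  also have "\<dots> = (1 - l * d) * exp (l * d) + l * exp (l * d) * y"
    by (simp add: algebra_simps)
  also have "(1 - l * d) * exp (l * d) \<le> 1"
    using exp_ge_add_one_self[of "- (l * d)"] by (simp add: exp_minus field_simps)
  finally show ?thesis using True by (simp add: tangent_slope_def)
next
  case False
  define m where "m = min d 1"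
  have m: "0 \<le> m" "m \<le> 1" using False by (auto simp: m_def)
  have psi: "0 \<le> psiE l" using psiE_nonneg[of l] l by auto
  \<comment> \<open>Since \<open>y \<le> 1\<close>, capping \<open>d\<close> at 1 moves it no
    farther from \<open>y\<close>.\<close>
  have "(y - m)\<^sup>2 \<le> (y - d)\<^sup>2"
    using y by (auto simp: m_def min_def abs_le_square_iff[symmetric])
  then have "exp (l * y - psiE l * (y - d)\<^sup>2) \<le> exp (l * y - psiE l * (y - m)\<^sup>2)"
    using psi by (simp add: mult_left_mono)
  also have "\<dots> \<le> 1 + (l + 2 * psiE l * (1 - l) * m) * y"
  proof (cases "0 \<le> y")
    case True
    then show ?thesis using exp_le_linear_pos[OF l m(1), of y] y by simp
  next
    case False
    have *: "(- y + m)\<^sup>2 = (y - m)\<^sup>2" by (simp add: power2_eq_square algebra_simps)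
    show ?thesis using exp_le_linear_neg[OF l m, of "- y"] y False unfolding * by simp
  qed
  finally show ?thesis using False by (simp add: tangent_slope_def m_def)
qed

subsection \<open>A maximal inequality\<close>

text \<open>Where \<open>f\<close> has reached \<open>c\<close> it is replaced by \<open>c\<close>,
  elsewhere it is kept. Retaining the integral over the part below \<open>c\<close>, which Markov's
  inequality drops, allows the step to be iterated.\<close>

lemma (in prob_space) indicator_markov:
  assumes S: "S \<in> events" and f: "integrable M f" and nonneg: "\<And>\<omega>. \<omega> \<in> space M \<Longrightarrow> 0 \<le> f \<omega>"
  shows "c * prob {\<omega>\<in>S. c \<le> f \<omega>} + (\<integral>\<omega>\<in>{\<omega>\<in>S. f \<omega> < c}. f \<omega> \<partial>M) \<le> (\<integral>\<omega>\<in>S. f \<omega> \<partial>M)"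
proof -
  have [measurable]: "f \<in> borel_measurable M" "S \<in> events" using f S by auto
  have SS: "S \<subseteq> space M" using S by (rule sets.sets_into_space)
  have eq: "{\<omega>\<in>S. c \<le> f \<omega>} = {\<omega>\<in>space M. \<omega> \<in> S \<and> c \<le> f \<omega>}"
    "{\<omega>\<in>S. f \<omega> < c} = {\<omega>\<in>space M. \<omega> \<in> S \<and> f \<omega> < c}"
    using SS by auto
  have [measurable]: "{\<omega>\<in>S. c \<le> f \<omega>} \<in> events" "{\<omega>\<in>S. f \<omega> < c} \<in> events"
    unfolding eq by measurable
  have int: "integrable M (\<lambda>\<omega>. indicator T \<omega> * f \<omega>)" if "T \<in> events" for T
    using integrable_mult_indicator[OF that f] by simp
  have int': "integrable M (\<lambda>\<omega>. c * indicator {\<omega>\<in>S. c \<le> f \<omega>} \<omega>)"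
    by (intro integrable_mult_right integrable_real_indicator) (auto simp: less_top[symmetric])
  have "c * prob {\<omega>\<in>S. c \<le> f \<omega>} + (\<integral>\<omega>\<in>{\<omega>\<in>S. f \<omega> < c}. f \<omega> \<partial>M) =
      (\<integral>\<omega>. c * indicator {\<omega>\<in>S. c \<le> f \<omega>} \<omega> + indicator {\<omega>\<in>S. f \<omega> < c} \<omega> * f \<omega> \<partial>M)"
    unfolding set_lebesgue_integral_def
    by (simp add: Bochner_Integration.integral_add[OF int' int])
  also have "\<dots> \<le> (\<integral>\<omega>. indicator S \<omega> * f \<omega> \<partial>M)"
    by (intro integral_mono Bochner_Integration.integrable_add int int')
      (auto simp: indicator_def nonneg)
  finally show ?thesis by (simp add: set_lebesgue_integral_def)
qed

text \<open>Ville's inequality. The supermartingale property is stated through integrals over sets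
  of \<open>F n\<close>, the form in which it is applied to the event of no crossing by time
  \<open>n\<close>.\<close>

lemma (in prob_space) supermartingale_maximal:
  fixes L :: "nat \<Rightarrow> 'a \<Rightarrow> real"
  assumes sub: "\<And>n. subalgebra M (F n)"
    and mono: "\<And>m n. m \<le> n \<Longrightarrow> sets (F m) \<subseteq> sets (F n)"
    and meas: "\<And>n. L n \<in> borel_measurable (F n)"
    and int: "\<And>n. integrable M (L n)"
    and nonneg: "\<And>n \<omega>. \<omega> \<in> space M \<Longrightarrow> 0 \<le> L n \<omega>"
    and super: "\<And>n S. S \<in> sets (F n) \<Longrightarrow> (\<integral>\<omega>\<in>S. L (Suc n) \<omega> \<partial>M) \<le> (\<integral>\<omega>\<in>S. L n \<omega> \<partial>M)"
    and c: "0 < c"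
  shows "prob {\<omega>\<in>space M. \<exists>n. c \<le> L n \<omega>} \<le> expectation (L 0) / c"
proof -
  define B where "B n = {\<omega>\<in>space M. \<forall>j\<in>{..n}. L j \<omega> < c}" for n
  define U where "U n = {\<omega>\<in>space M. \<exists>j\<in>{..n}. c \<le> L j \<omega>}" for n
  have space: "space (F n) = space M" for n using sub by (auto simp: subalgebra_def)
  have [measurable]: "L j \<in> borel_measurable M" for j using int by auto
  have [measurable]: "U n \<in> events" "B n \<in> events" for n unfolding U_def B_def by measurable
  have meas': "L j \<in> borel_measurable (F n)" if "j \<le> n" for j n
    using meas[of j] mono[OF that] by (auto simp: measurable_def space)
  have BF: "B n \<in> sets (F n)" for n
  proof -
    have "{\<omega>\<in>space (F n). \<forall>j\<in>{..n}. L j \<omega> < c} \<in> sets (F n)"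
      by (intro sets.sets_Collect_finite_All' borel_measurable_less) (auto intro: meas')
    then show ?thesis by (simp add: B_def space)
  qed
  \<comment> \<open>The invariant stops the process at its first crossing: paths that have crossed
    count \<open>c\<close>, those in \<open>B n\<close> still carry \<open>L n\<close>.\<close>
  have inv: "c * prob (U n) + (\<integral>\<omega>\<in>B n. L n \<omega> \<partial>M) \<le> expectation (L 0)" for n
  proof (induction n)
    case 0
    have "(\<integral>\<omega>\<in>space M. L 0 \<omega> \<partial>M) = expectation (L 0)"
      by (simp add: set_lebesgue_integral_def cong: Bochner_Integration.integral_cong)
    moreover have "U 0 = {\<omega>\<in>space M. c \<le> L 0 \<omega>}" "B 0 = {\<omega>\<in>space M. L 0 \<omega> < c}"
      by (auto simp: U_def B_def)
    ultimately show ?case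
      using indicator_markov[OF sets.top int[of 0] nonneg, of c] by simp
  next
    case (Suc n)
    \<comment> \<open>The paths whose first crossing happens at time \<open>n + 1\<close>.\<close>
    let ?D = "{\<omega>\<in>B n. c \<le> L (Suc n) \<omega>}"
    have D: "?D = {\<omega>\<in>space M. \<omega> \<in> B n \<and> c \<le> L (Suc n) \<omega>}" by (auto simp: B_def)
    have Dm: "?D \<in> events" unfolding D by measurable
    have "U (Suc n) = U n \<union> ?D" by (auto simp: U_def B_def atMost_Suc not_less)
    moreover have "U n \<inter> ?D = {}" by (force simp: U_def B_def)
    ultimately have "prob (U (Suc n)) = prob (U n) + prob ?D"
      using Dm by (simp add: finite_measure_Union)
    moreover have "B (Suc n) = {\<omega>\<in>B n. L (Suc n) \<omega> < c}" by (auto simp: B_def atMost_Suc)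
    then have "c * prob ?D + (\<integral>\<omega>\<in>B (Suc n). L (Suc n) \<omega> \<partial>M) \<le> (\<integral>\<omega>\<in>B n. L (Suc n) \<omega> \<partial>M)"
      using indicator_markov[OF _ int[of "Suc n"] nonneg, of "B n" c] by simp
    moreover have "(\<integral>\<omega>\<in>B n. L (Suc n) \<omega> \<partial>M) \<le> (\<integral>\<omega>\<in>B n. L n \<omega> \<partial>M)"
      by (rule super[OF BF])
    ultimately show ?case using Suc by (simp add: algebra_simps)
  qed
  have "prob (U n) \<le> expectation (L 0) / c" for n
  proof -
    have "0 \<le> (\<integral>\<omega>\<in>B n. L n \<omega> \<partial>M)"
      unfolding set_lebesgue_integral_def by (intro integral_nonneg_AE AE_I2) (auto simp: nonneg)
    then show ?thesis using inv[of n] c by (simp add: field_simps)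
  qed
  \<comment> \<open>The bound is uniform in \<open>n\<close> and the events \<open>U n\<close>
    increase, so it passes to their union.\<close>
  moreover have "(\<lambda>n. prob (U n)) \<longlonglongrightarrow> prob (\<Union>n. U n)"
    by (intro finite_Lim_measure_incseq) (auto simp: incseq_def U_def intro: order_trans)
  ultimately have "prob (\<Union>n. U n) \<le> expectation (L 0) / c"
    by (intro LIMSEQ_le_const2) auto
  moreover have "(\<Union>n. U n) = {\<omega>\<in>space M. \<exists>n. c \<le> L n \<omega>}" by (auto simp: U_def)
  ultimately show ?thesis by simp
qed

subsection \<open>The adaptive experiment\<close>

lemma pre_sets_subset: "f \<in> measurable M N \<Longrightarrow> pre_sets M N f \<subseteq> sets M"
  by (auto simp: pre_sets_def)

lemma measurable_sigma_pre_sets: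
  assumes "f \<in> space M \<rightarrow> space N" "pre_sets M N f \<subseteq> G" "G \<subseteq> Pow (space M)"
  shows "f \<in> measurable (sigma (space M) G) N"
  using assms by (intro measurableI) (auto simp: pre_sets_def sets_measure_of space_measure_of)

lemma tangent_slope_measurable [measurable]:
  assumes [measurable]: "f \<in> borel_measurable N" "g \<in> borel_measurable N"
  shows "(\<lambda>\<omega>. tangent_slope (f \<omega>) (g \<omega>)) \<in> borel_measurable N"
  unfolding tangent_slope_def psiE_def by measurable

lemma psiE_measurable [measurable]: "psiE \<in> borel_measurable borel"
  unfolding psiE_def by measurable

text \<open>Positivity comes from \<open>s0 > 0\<close>, which keeps the variance estimate positive
  even at \<open>t = 1\<close>, where its sum is empty.\<close>

lemma lam_bounds:
  assumes "0 < \<alpha>" "\<alpha> < 1" "0 < s0" "1 \<le> t"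
  shows "0 < lam \<alpha> s0 k h t" "lam \<alpha> s0 k h t \<le> 1/2"
proof -
  have "0 < s0 + (\<Sum>i=1..t - 1. (xi k h i - xibar k h i)\<^sup>2)"
    using assms by (intro add_pos_nonneg sum_nonneg) auto
  then have "0 < sighat2 s0 k h (t - 1)"
    unfolding sighat2_def by (rule divide_pos_pos) simp
  moreover have "0 < ln (2 / \<alpha>)" using assms by simp
  ultimately show "0 < lam \<alpha> s0 k h t" using assms by (simp add: lam_def)
qed (simp add: lam_def)

text \<open>\<open>hist\<close> at \<open>t\<close> is the past before round \<open>t\<close>, so
  \<open>fhat t\<close> is measurable at index \<open>Suc t\<close>. In \<open>p_cond\<close> the
  conditioning includes both current potential outcomes: this encodes that the treatment is drawn
  independently of them given covariate and past.\<close>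

locale adaptive_experiment = prob_space M for M :: "'a measure" +
  fixes Mx :: "'x measure" and X :: "nat \<Rightarrow> 'a \<Rightarrow> 'x" and A :: "nat \<Rightarrow> 'a \<Rightarrow> bool"
    and Y0 Y1 :: "nat \<Rightarrow> 'a \<Rightarrow> real" and p :: "nat \<Rightarrow> 'a \<Rightarrow> real"
    and fhat :: "nat \<Rightarrow> bool \<Rightarrow> 'x \<Rightarrow> 'a \<Rightarrow> real" and k :: "nat \<Rightarrow> real"
  assumes X_meas [measurable]: "\<And>t. X t \<in> measurable M Mx"
    and A_meas [measurable]: "\<And>t. A t \<in> measurable M (count_space UNIV)"
    and Y0_meas [measurable]: "\<And>t. Y0 t \<in> borel_measurable M"
    and Y1_meas [measurable]: "\<And>t. Y1 t \<in> borel_measurable M"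
    and Y_bounds: "\<And>t \<omega>. t \<ge> 1 \<Longrightarrow> \<omega> \<in> space M \<Longrightarrow> Y0 t \<omega> \<in> {0..1} \<and> Y1 t \<omega> \<in> {0..1}"
    and iid_distr: "\<And>t. t \<ge> 1 \<Longrightarrow>
        distr M (Mx \<Otimes>\<^sub>M borel \<Otimes>\<^sub>M borel) (\<lambda>\<omega>. (X t \<omega>, Y0 t \<omega>, Y1 t \<omega>))
      = distr M (Mx \<Otimes>\<^sub>M borel \<Otimes>\<^sub>M borel) (\<lambda>\<omega>. (X 1 \<omega>, Y0 1 \<omega>, Y1 1 \<omega>))"
    and fresh: "\<And>t. t \<ge> 1 \<Longrightarrow> indep_set
        (sigma_sets (space M) (pre_sets M (Mx \<Otimes>\<^sub>M borel \<Otimes>\<^sub>M borel)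
            (\<lambda>\<omega>. (X t \<omega>, Y0 t \<omega>, Y1 t \<omega>))))
        (sets (hist M Mx X A Y0 Y1 t))"
    and p_meas: "\<And>t. t \<ge> 1 \<Longrightarrow> p t \<in> borel_measurable (histX M Mx X A Y0 Y1 t)"
    and p_cond: "\<And>t. t \<ge> 1 \<Longrightarrow>
        AE \<omega> in M. real_cond_exp M (histXY M Mx X A Y0 Y1 t) (\<lambda>\<omega>. indicator {\<omega>. A t \<omega>} \<omega>) \<omega> = p t \<omega>"
    and k_ge: "\<And>t. t \<ge> 1 \<Longrightarrow> k t \<ge> 2"
    and p_trunc: "\<And>t \<omega>. t \<ge> 1 \<Longrightarrow> \<omega> \<in> space M \<Longrightarrow> 1 / k t \<le> p t \<omega> \<and> p t \<omega> \<le> 1 - 1 / k t"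
    and fhat_meas: "\<And>t a. (\<lambda>(x, \<omega>). fhat t a x \<omega>)
        \<in> borel_measurable (Mx \<Otimes>\<^sub>M hist M Mx X A Y0 Y1 (Suc t))"
    and fhat_bounds: "\<And>t a x \<omega>. fhat t a x \<omega> \<in> {0..1}"
begin

abbreviation "H \<equiv> hist M Mx X A Y0 Y1"
abbreviation "HX \<equiv> histX M Mx X A Y0 Y1"
abbreviation "HXY \<equiv> histXY M Mx X A Y0 Y1"

definition \<theta> :: real where "\<theta> = expectation (\<lambda>\<omega>. Y1 1 \<omega> - Y0 1 \<omega>)"

section \<open>Histories as sigma-algebras and adaptedness of \<open>hseq\<close>\<close>

lemma Yobs_meas [measurable]: "Yobs A Y0 Y1 t \<in> borel_measurable M"
  unfolding Yobs_def[abs_def] by measurable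

lemma hist_generators:
  "(\<Union>s\<in>{1..<t}. pre_sets M Mx (X s) \<union> pre_sets M (count_space UNIV) (A s)
      \<union> pre_sets M borel (Yobs A Y0 Y1 s)) \<subseteq> events"
  using pre_sets_subset[OF X_meas] pre_sets_subset[OF A_meas] pre_sets_subset[OF Yobs_meas]
  by blast

lemma subalgebra_sigma: "G \<subseteq> events \<Longrightarrow> subalgebra M (sigma (space M) G)"
  using sets.space_closed[of M]
  by (auto simp: subalgebra_def space_measure_of_conv intro!: sets.sigma_sets_subset
      simp: sets_measure_of subset_trans dest!: subsetD[OF sets.sigma_sets_subset, rotated])

lemma subalgebra_hist: "subalgebra M (H t)"
  unfolding hist_def by (rule subalgebra_sigma[OF hist_generators])

lemma sets_hist_subset: "sets (H t) \<subseteq> events"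
  using subalgebra_hist[of t] by (simp add: subalgebra_def)

lemma subalgebra_histX: "subalgebra M (HX t)"
  unfolding histX_def using pre_sets_subset[OF X_meas] sets_hist_subset
  by (intro subalgebra_sigma) blast

lemma subalgebra_histXY: "subalgebra M (HXY t)"
  unfolding histXY_def
  using pre_sets_subset[OF X_meas] pre_sets_subset[OF Y0_meas] pre_sets_subset[OF Y1_meas]
    sets_hist_subset
  by (intro subalgebra_sigma) blast

lemma spaces: "space (H t) = space M" "space (HX t) = space M" "space (HXY t) = space M"
  using subalgebra_hist[of t] subalgebra_histX[of t] subalgebra_histXY[of t]
  by (auto simp: subalgebra_def)

lemma Pow_events: "G \<subseteq> events \<Longrightarrow> G \<subseteq> Pow (space M)"
  using sets.space_closed[of M] by blast

lemma sets_hist: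
  "sets (H t) = sigma_sets (space M) (\<Union>s\<in>{1..<t}. pre_sets M Mx (X s) \<union>
     pre_sets M (count_space UNIV) (A s) \<union> pre_sets M borel (Yobs A Y0 Y1 s))"
  unfolding hist_def by (rule sets_measure_of[OF Pow_events[OF hist_generators]])

lemma hist_mono: "s \<le> t \<Longrightarrow> sets (H s) \<subseteq> sets (H t)"
  unfolding sets_hist by (intro sigma_sets_mono' UN_mono) auto

lemma hist_measurable:
  assumes "1 \<le> s" "s < t"
  shows "X s \<in> measurable (H t) Mx" "A s \<in> measurable (H t) (count_space UNIV)"
    "Yobs A Y0 Y1 s \<in> borel_measurable (H t)"
  unfolding hist_def using assms Pow_events[OF hist_generators]
  by (intro measurable_sigma_pre_sets; auto dest: measurable_space[OF X_meas])+

lemma sets_histX: "sets (HX t) = sigma_sets (space M) (pre_sets M Mx (X t) \<union> sets (H t))"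
  unfolding histX_def
  by (intro sets_measure_of Pow_events Un_least pre_sets_subset X_meas sets_hist_subset)

lemma sets_histXY: "sets (HXY t) = sigma_sets (space M) (pre_sets M Mx (X t) \<union>
    pre_sets M borel (Y0 t) \<union> pre_sets M borel (Y1 t) \<union> sets (H t))"
  unfolding histXY_def
  by (intro sets_measure_of Pow_events Un_least pre_sets_subset X_meas Y0_meas Y1_meas sets_hist_subset)

lemma subalgebra_histX_hist: "subalgebra (HX t) (H t)"
  unfolding subalgebra_def spaces sets_histX by auto

lemma subalgebra_histXY_histX: "subalgebra (HXY t) (HX t)"
  unfolding subalgebra_def spaces sets_histX sets_histXY by (intro conjI refl sigma_sets_mono') auto

lemma subalgebra_hist_histX:
  assumes "1 \<le> t"
  shows "subalgebra (H (Suc t)) (HX t)"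
proof -
  have "pre_sets M Mx (X t) \<subseteq> sets (H (Suc t))"
    using measurable_sets[OF hist_measurable(1)[OF assms, of "Suc t"]]
    by (auto simp: pre_sets_def spaces)
  then have "pre_sets M Mx (X t) \<union> sets (H t) \<subseteq> sets (H (Suc t))"
    using hist_mono[of t "Suc t"] by simp
  then show ?thesis
    unfolding subalgebra_def sets_histX
    using sets.sigma_sets_subset[of _ "H (Suc t)"] by (simp add: spaces)
qed

lemma histX_measurable: "X t \<in> measurable (HX t) Mx"
  unfolding histX_def using pre_sets_subset[OF X_meas] sets_hist_subset
  by (intro measurable_sigma_pre_sets Pow_events) (auto dest: measurable_space[OF X_meas])

lemma histXY_measurable:
  "Y0 t \<in> borel_measurable (HXY t)" "Y1 t \<in> borel_measurable (HXY t)"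
  unfolding histXY_def
  using pre_sets_subset[OF X_meas] pre_sets_subset[OF Y0_meas] pre_sets_subset[OF Y1_meas]
    sets_hist_subset
  by (intro measurable_sigma_pre_sets Pow_events; auto)+

text \<open>Joint measurability of the estimator enters because it is evaluated at the random point
  \<open>X t\<close>. The indices match since \<open>Suc (t - 1) = t\<close> for
  \<open>t \<ge> 1\<close>.\<close>

lemma fhat_X_measurable:
  assumes "1 \<le> t"
  shows "(\<lambda>\<omega>. fhat (t - 1) a (X t \<omega>) \<omega>) \<in> borel_measurable (HX t)"
proof -
  have "(\<lambda>\<omega>. (X t \<omega>, \<omega>)) \<in> measurable (HX t) (Mx \<Otimes>\<^sub>M H t)"
    by (intro measurable_Pair histX_measurable measurable_from_subalg[OF subalgebra_histX_hist])
      (rule measurable_ident_sets[OF refl])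
  from measurable_compose[OF this, of "\<lambda>(x, \<omega>). fhat (t - 1) a x \<omega>" borel]
  show ?thesis using fhat_meas[of "t - 1" a] assms by simp
qed

lemma hseq_measurable:
  assumes "1 \<le> s" "s < t"
  shows "hseq X A Y0 Y1 p fhat s \<in> borel_measurable (H t)"
proof -
  have sub: "subalgebra (H t) (HX s)"
    using subalgebra_hist_histX[OF assms(1)] hist_mono[of "Suc s" t] assms
    by (auto simp: subalgebra_def spaces)
  note [measurable] = hist_measurable[OF assms] measurable_from_subalg[OF sub p_meas[OF assms(1)]]
    measurable_from_subalg[OF sub fhat_X_measurable[OF assms(1)]]
  show ?thesis unfolding hseq_def[abs_def] by measurable
qed

section \<open>Size and conditional mean of \<open>hseq\<close>\<close>

lemma propensity_bounds:
  assumes "1 \<le> t" "\<omega> \<in> space M"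
  shows "0 < p t \<omega>" "p t \<omega> < 1" "1 / p t \<omega> \<le> k t" "1 / (1 - p t \<omega>) \<le> k t"
proof -
  have k: "0 < 1 / k t" using k_ge[OF assms(1)] by simp
  then show p: "0 < p t \<omega>" "p t \<omega> < 1" using p_trunc[OF assms] by linarith+
  have "1 \<le> p t \<omega> * k t" "1 \<le> (1 - p t \<omega>) * k t"
    using p_trunc[OF assms] k_ge[OF assms(1)] by (auto simp: field_simps)
  with p show "1 / p t \<omega> \<le> k t" "1 / (1 - p t \<omega>) \<le> k t" by (auto simp: field_simps)
qed

text \<open>The bound \<open>k t\<close>, rather than the \<open>k t + 1\<close> of the triangle
  inequality, leaves room for subtracting \<open>\<theta>\<close> in
  \<open>xi_centered\<close>.\<close>

lemma hseq_bound:
  assumes "1 \<le> t" "\<omega> \<in> space M"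
  shows "\<bar>hseq X A Y0 Y1 p fhat t \<omega>\<bar> \<le> k t"
proof -
  have *: "\<bar>(y - f) / q + f - g\<bar> \<le> 1 / q"
    if "y \<in> {0..1}" "f \<in> {0..1}" "g \<in> {0..1}" "0 < q" "q < 1" for y f g q :: real
  proof -
    \<comment> \<open>After multiplication by \<open>q\<close> the score becomes \<open>y\<close>
      minus the convex combination \<open>f * (1 - q) + g * q\<close> of values in [0, 1].\<close>
    define a b where "a = f * (1 - q)" and "b = g * q"
    have "0 \<le> a" "0 \<le> b" using that by (auto simp: a_def b_def)
    moreover have "a \<le> 1 * (1 - q)" "b \<le> 1 * q"
      unfolding a_def b_def using that by (intro mult_right_mono; simp)+
    ultimately have "y - a - b \<le> 1" "-1 \<le> y - a - b" using that by auto
    moreover have "y - f + (f - g) * q = y - a - b" by (simp add: a_def b_def algebra_simps)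
    ultimately have "y - f + (f - g) * q \<le> 1" "-1 \<le> y - f + (f - g) * q" by simp_all
    then have "\<bar>y - f + (f - g) * q\<bar> / q \<le> 1 / q" using that by (intro divide_right_mono) auto
    moreover have "(y - f) / q + f - g = (y - f + (f - g) * q) / q"
      using that by (simp add: field_simps)
    ultimately show ?thesis using that by (simp add: abs_divide)
  qed
  let ?f = "\<lambda>a. fhat (t - 1) a (X t \<omega>) \<omega>"
  note pb = propensity_bounds[OF assms]
  show ?thesis
  proof (cases "A t \<omega>")
    case True
    then have "hseq X A Y0 Y1 p fhat t \<omega> = (Y1 t \<omega> - ?f True) / p t \<omega> + ?f True - ?f False"
      by (simp add: hseq_def Yobs_def)
    then show ?thesis
      using *[of "Y1 t \<omega>" "?f True" "?f False" "p t \<omega>"] Y_bounds[OF assms] fhat_bounds pb by simp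
  next
    case False
    then have eq: "hseq X A Y0 Y1 p fhat t \<omega> =
        - ((Y0 t \<omega> - ?f False) / (1 - p t \<omega>) + ?f False - ?f True)"
      by (simp add: hseq_def Yobs_def)
    have "\<bar>(Y0 t \<omega> - ?f False) / (1 - p t \<omega>) + ?f False - ?f True\<bar> \<le> 1 / (1 - p t \<omega>)"
      by (rule *) (use Y_bounds[OF assms] fhat_bounds pb in auto)
    then show ?thesis
      unfolding eq abs_minus_cancel using pb by linarith
  qed
qed

lemma integrable_bounded:
  assumes "f \<in> borel_measurable M" "\<And>\<omega>. \<omega> \<in> space M \<Longrightarrow> \<bar>f \<omega>\<bar> \<le> (B::real)"
  shows "integrable M f"
  using assms by (intro integrable_const_bound[of _ B]) auto

lemma effect_bounds:
  assumes "1 \<le> t" "\<omega> \<in> space M"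
  shows "-1 \<le> Y1 t \<omega> - Y0 t \<omega>" "Y1 t \<omega> - Y0 t \<omega> \<le> 1"
  using Y_bounds[OF assms] by auto

lemma effect_integrable:
  assumes "1 \<le> t"
  shows "integrable M (\<lambda>\<omega>. Y1 t \<omega> - Y0 t \<omega>)"
proof (rule integrable_bounded)
  show "\<bar>Y1 t \<omega> - Y0 t \<omega>\<bar> \<le> 1" if "\<omega> \<in> space M" for \<omega>
    using effect_bounds[OF assms that] by linarith
qed measurable

text \<open>The effect is a function of the tuple of round \<open>t\<close>, which
  \<open>fresh\<close> makes independent of the past; \<open>iid_distr\<close> carries its mean over
  to round 1.\<close>

lemma effect_indep_hist:
  assumes t: "1 \<le> t" and G: "G \<in> borel_measurable (H t)"
    and B: "\<And>\<omega>. \<omega> \<in> space M \<Longrightarrow> \<bar>G \<omega>\<bar> \<le> B"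
  shows "expectation (\<lambda>\<omega>. G \<omega> * (Y1 t \<omega> - Y0 t \<omega>)) = expectation G * \<theta>"
proof -
  have [measurable]: "G \<in> borel_measurable M"
    by (rule measurable_from_subalg[OF subalgebra_hist G])
  let ?N = "Mx \<Otimes>\<^sub>M borel \<Otimes>\<^sub>M borel :: ('x \<times> real \<times> real) measure"
  let ?V = "\<lambda>t \<omega>. (X t \<omega>, Y0 t \<omega>, Y1 t \<omega>)"
  let ?d = "\<lambda>(x :: 'x, y0, y1). y1 - y0 :: real"
  have d: "?d \<in> borel_measurable ?N" by measurable
  have V: "?V t \<in> measurable M ?N" for t by measurable
  let ?SG = "sigma_sets (space M) {G -` A \<inter> space M |A. A \<in> sets borel}"
  let ?SY = "sigma_sets (space M) {(\<lambda>\<omega>. Y1 t \<omega> - Y0 t \<omega>) -` A \<inter> space M |A. A \<in> sets borel}"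
  have "{G -` A \<inter> space M |A. A \<in> sets borel} \<subseteq> sets (H t)"
    using measurable_sets[OF G] by (auto simp: spaces)
  then have SG: "?SG \<subseteq> sets (H t)"
    using sets.sigma_sets_subset[of _ "H t"] by (simp add: spaces)
  have SY: "?SY \<subseteq> sigma_sets (space M) (pre_sets M ?N (?V t))"
  proof (intro sigma_sets_mono', safe)
    fix S :: "real set" assume "S \<in> sets borel"
    then have "?d -` S \<inter> space ?N \<in> sets ?N" using d by (rule measurable_sets[rotated])
    moreover have "(\<lambda>\<omega>. Y1 t \<omega> - Y0 t \<omega>) -` S \<inter> space M = ?V t -` (?d -` S \<inter> space ?N) \<inter> space M"
      using measurable_space[OF V[of t]] by auto
    ultimately show "(\<lambda>\<omega>. Y1 t \<omega> - Y0 t \<omega>) -` S \<inter> space M \<in> pre_sets M ?N (?V t)"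
      unfolding pre_sets_def by blast
  qed
  have "indep_set ?SG ?SY"
    unfolding indep_sets2_eq
  proof (intro conjI ballI)
    note fr = fresh[OF t, unfolded indep_sets2_eq]
    show "?SG \<subseteq> events" "?SY \<subseteq> events" using SG SY fr by (meson order_trans)+
    fix a b assume "a \<in> ?SG" "b \<in> ?SY"
    then have "prob (b \<inter> a) = prob b * prob a" using fr SG SY by (meson subsetD)
    then show "prob (a \<inter> b) = prob a * prob b" by (simp add: Int_commute mult.commute)
  qed
  then have "indep_var borel G borel (\<lambda>\<omega>. Y1 t \<omega> - Y0 t \<omega>)"
    unfolding indep_var_eq by simp
  then have "expectation (\<lambda>\<omega>. G \<omega> * (Y1 t \<omega> - Y0 t \<omega>)) =
      expectation G * expectation (\<lambda>\<omega>. Y1 t \<omega> - Y0 t \<omega>)"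
  proof (rule indep_var_lebesgue_integral)
    show "integrable M G" using B by (intro integrable_bounded) auto
    show "integrable M (\<lambda>\<omega>. Y1 t \<omega> - Y0 t \<omega>)" by (rule effect_integrable[OF t])
  qed
  also have "expectation (\<lambda>\<omega>. Y1 t \<omega> - Y0 t \<omega>) = integral\<^sup>L (distr M ?N (?V t)) ?d"
    by (subst integral_distr[OF V d]) simp
  also have "\<dots> = \<theta>"
    unfolding iid_distr[OF t] \<theta>_def by (subst integral_distr[OF V d]) simp
  finally show ?thesis .
qed

text \<open>Conditional unbiasedness, tested against bounded functions of the past. Averaging over
  the treatment draw cancels the inverse weights, the values of \<open>fhat\<close> drop out, and
  the effect of round \<open>t\<close> remains.\<close>

lemma expectation_hseq:
  assumes t: "1 \<le> t" and G: "G \<in> borel_measurable (H t)"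
    and B: "\<And>\<omega>. \<omega> \<in> space M \<Longrightarrow> \<bar>G \<omega>\<bar> \<le> B"
  shows "expectation (\<lambda>\<omega>. G \<omega> * hseq X A Y0 Y1 p fhat t \<omega>) = expectation G * \<theta>"
proof -
  interpret S: finite_measure_subalgebra M "HXY t"
    by standard (rule subalgebra_histXY)
  have sub: "subalgebra (HXY t) (HX t)" "subalgebra (HXY t) (H t)"
    using subalgebra_histXY_histX[of t] subalgebra_histX_hist[of t] by (auto simp: subalgebra_def)
  define f where "f a \<omega> = fhat (t - 1) a (X t \<omega>) \<omega>" for a \<omega>
  define V1 where "V1 \<omega> = (Y1 t \<omega> - f True \<omega>) / p t \<omega>" for \<omega>
  define V0 where "V0 \<omega> = (Y0 t \<omega> - f False \<omega>) / (1 - p t \<omega>)" for \<omega>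
  \<comment> \<open>\<open>G\<close> times the score is affine in the treatment indicator: it equals
    \<open>Z * I + R\<close> with \<open>Z\<close> and \<open>R\<close> measurable for
    \<open>HXY t\<close>.\<close>
  define Z where "Z \<omega> = G \<omega> * (V1 \<omega> + V0 \<omega>)" for \<omega>
  define R where "R \<omega> = G \<omega> * (f True \<omega> - f False \<omega> - V0 \<omega>)" for \<omega>
  define I :: "'a \<Rightarrow> real" where "I \<omega> = indicator {\<omega>. A t \<omega>} \<omega>" for \<omega>
  have f_meas [measurable]: "f a \<in> borel_measurable (HXY t)" for a
    unfolding f_def by (rule measurable_from_subalg[OF sub(1) fhat_X_measurable[OF t]])
  note [measurable] = measurable_from_subalg[OF sub(1) p_meas[OF t]]
    measurable_from_subalg[OF sub(2) G] histXY_measurable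
  have Z [measurable]: "Z \<in> borel_measurable (HXY t)"
    unfolding Z_def[abs_def] V1_def V0_def by measurable
  have R [measurable]: "R \<in> borel_measurable (HXY t)"
    unfolding R_def[abs_def] V0_def by measurable
  note [measurable] = measurable_from_subalg[OF subalgebra_histXY Z]
    measurable_from_subalg[OF subalgebra_histXY R]
  have p_M [measurable]: "p t \<in> borel_measurable M"
    by (rule measurable_from_subalg[OF subalgebra_histX p_meas[OF t]])
  have I [measurable]: "I \<in> borel_measurable M" unfolding I_def[abs_def] by measurable
  have V: "\<bar>V1 \<omega>\<bar> \<le> k t" "\<bar>V0 \<omega>\<bar> \<le> k t" if "\<omega> \<in> space M" for \<omega>
  proof -
    have *: "\<bar>(y - g) / q\<bar> \<le> k t" if "y \<in> {0..1}" "g \<in> {0..1}" "0 < q" "1 / q \<le> k t"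
      for y g q :: real
    proof -
      have "\<bar>y - g\<bar> / q \<le> 1 / q" using that by (intro divide_right_mono) auto
      then show ?thesis using that by (simp add: abs_divide)
    qed
    show "\<bar>V1 \<omega>\<bar> \<le> k t" "\<bar>V0 \<omega>\<bar> \<le> k t"
      unfolding V1_def V0_def f_def
      using Y_bounds[OF t that] fhat_bounds propensity_bounds[OF t that] by (intro *; simp)+
  qed
  have mult: "\<bar>G \<omega> * v\<bar> \<le> B * C" if "\<omega> \<in> space M" "\<bar>v\<bar> \<le> C" for \<omega> v C
    unfolding abs_mult using B[OF that(1)] that(2) by (intro mult_mono) auto
  have Z_bound: "\<bar>Z \<omega>\<bar> \<le> B * (2 * k t)" if "\<omega> \<in> space M" for \<omega>
    unfolding Z_def using V[OF that] by (intro mult that) auto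
  have R_bound: "\<bar>R \<omega>\<bar> \<le> B * (1 + k t)" if "\<omega> \<in> space M" for \<omega>
    unfolding R_def
    using V[OF that] fhat_bounds[of "t - 1" True "X t \<omega>" \<omega>] fhat_bounds[of "t - 1" False "X t \<omega>" \<omega>]
    by (intro mult that) (auto simp: f_def abs_le_iff)
  have I01: "\<bar>I \<omega>\<bar> \<le> 1" for \<omega> by (simp add: I_def indicator_def)
  have ZI: "integrable M (\<lambda>\<omega>. Z \<omega> * I \<omega>)"
  proof (rule integrable_bounded)
    show "\<bar>Z \<omega> * I \<omega>\<bar> \<le> B * (2 * k t)" if "\<omega> \<in> space M" for \<omega>
      using Z_bound[OF that] by (auto simp: I_def indicator_def split: if_splits)
  qed measurable
  have Zp: "integrable M (\<lambda>\<omega>. Z \<omega> * p t \<omega>)"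
  proof (rule integrable_bounded)
    show "\<bar>Z \<omega> * p t \<omega>\<bar> \<le> B * (2 * k t) * 1" if "\<omega> \<in> space M" for \<omega>
      unfolding abs_mult using Z_bound[OF that] propensity_bounds[OF t that]
      by (intro mult_mono) auto
  qed measurable
  have iR: "integrable M R" by (rule integrable_bounded[OF _ R_bound]) auto
  have "expectation (\<lambda>\<omega>. G \<omega> * hseq X A Y0 Y1 p fhat t \<omega>) = expectation (\<lambda>\<omega>. Z \<omega> * I \<omega> + R \<omega>)"
    by (intro Bochner_Integration.integral_cong)
      (auto simp: hseq_def Yobs_def Z_def R_def I_def V1_def V0_def f_def algebra_simps)
  also have "\<dots> = expectation (\<lambda>\<omega>. Z \<omega> * I \<omega>) + expectation R"
    by (rule Bochner_Integration.integral_add[OF ZI iR])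
  \<comment> \<open>As \<open>Z\<close> is measurable for \<open>HXY t\<close>, the indicator may be
    replaced by its conditional expectation, the propensity.\<close>
  also have "expectation (\<lambda>\<omega>. Z \<omega> * I \<omega>) = expectation (\<lambda>\<omega>. Z \<omega> * real_cond_exp M (HXY t) I \<omega>)"
    by (rule S.real_cond_exp_intg(2)[symmetric, OF ZI Z I])
  also have "\<dots> = expectation (\<lambda>\<omega>. Z \<omega> * p t \<omega>)"
    using p_cond[OF t] by (intro integral_cong_AE) (auto simp: I_def[abs_def])
  also have "\<dots> + expectation R = expectation (\<lambda>\<omega>. Z \<omega> * p t \<omega> + R \<omega>)"
    by (rule Bochner_Integration.integral_add[OF Zp iR, symmetric])
  also have "\<dots> = expectation (\<lambda>\<omega>. G \<omega> * (Y1 t \<omega> - Y0 t \<omega>))"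
  proof (intro Bochner_Integration.integral_cong refl)
    fix \<omega> assume "\<omega> \<in> space M"
    note pb = propensity_bounds[OF t this]
    have "V1 \<omega> * p t \<omega> = Y1 t \<omega> - f True \<omega>" "V0 \<omega> * (1 - p t \<omega>) = Y0 t \<omega> - f False \<omega>"
      using pb by (auto simp: V1_def V0_def)
    moreover have "Z \<omega> * p t \<omega> + R \<omega> =
        G \<omega> * (V1 \<omega> * p t \<omega> - V0 \<omega> * (1 - p t \<omega>) + f True \<omega> - f False \<omega>)"
      by (simp add: Z_def R_def algebra_simps)
    ultimately show "Z \<omega> * p t \<omega> + R \<omega> = G \<omega> * (Y1 t \<omega> - Y0 t \<omega>)" by simp
  qed
  also have "\<dots> = expectation G * \<theta>" by (rule effect_indep_hist[OF t G B])
  finally show ?thesis .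
qed


subsection \<open>The wealth processes\<close>

abbreviation "h \<omega> \<equiv> (\<lambda>t. hseq X A Y0 Y1 p fhat t \<omega>)"

lemma xi_measurable:
  assumes "1 \<le> s" "s < t"
  shows "(\<lambda>\<omega>. xi k (h \<omega>) s) \<in> borel_measurable (H t)"
  unfolding xi_def using hseq_measurable[OF assms] by (rule borel_measurable_divide) simp

text \<open>The sum stops at \<open>t - 1\<close> and \<open>k\<close> is deterministic, so the
  predictor for round \<open>t\<close> is known beforehand. The same holds for \<open>lam\<close>,
  which reads \<open>sighat2\<close> at \<open>t - 1\<close>.\<close>

lemma xihat_measurable: "(\<lambda>\<omega>. xihat k (h \<omega>) t) \<in> borel_measurable (H t)"
  unfolding xihat_def
  by (intro borel_measurable_min borel_measurable_divide borel_measurable_sum xi_measurable) auto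

lemma lam_measurable:
  assumes "1 \<le> t"
  shows "(\<lambda>\<omega>. lam \<alpha> s0 k (h \<omega>) t) \<in> borel_measurable (H t)"
proof -
  have [measurable]: "(\<lambda>\<omega>. sighat2 s0 k (h \<omega>) (t - 1)) \<in> borel_measurable (H t)"
    unfolding sighat2_def xibar_def
    using assms
    by (intro borel_measurable_divide borel_measurable_add borel_measurable_sum
        borel_measurable_power borel_measurable_diff borel_measurable_min xi_measurable) auto
  show ?thesis unfolding lam_def by measurable
qed

text \<open>The score is bounded by \<open>k t\<close> and the mean effect by 1, which is why
  \<open>k t + 1\<close> is the right scale.\<close>

lemma xi_centered:
  assumes "1 \<le> t" "\<omega> \<in> space M"
  shows "\<bar>xi k (h \<omega>) t - \<theta> / (k t + 1)\<bar> \<le> 1"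
proof -
  have k: "0 < k t + 1" using k_ge[OF assms(1)] by simp
  have "\<bar>\<theta>\<bar> \<le> 1"
  proof -
    have "-1 \<le> \<theta>" "\<theta> \<le> 1"
      unfolding \<theta>_def using effect_bounds[of 1] effect_integrable[of 1]
      by (intro integral_ge_const integral_le_const AE_I2; simp)+
    then show ?thesis by simp
  qed
  then have "\<bar>h \<omega> t - \<theta>\<bar> \<le> k t + 1" using hseq_bound[OF assms] by linarith
  then have "\<bar>h \<omega> t - \<theta>\<bar> / (k t + 1) \<le> 1" using k by simp
  then show ?thesis using k by (simp add: xi_def abs_divide flip: diff_divide_distrib)
qed

text \<open>The sign \<open>s\<close> selects the side: for \<open>s = 1\<close> the product grows
  large when \<open>\<theta>\<close> falls below an interval, for \<open>s = -1\<close> when it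
  falls above.\<close>

definition factor :: "real \<Rightarrow> real \<Rightarrow> real \<Rightarrow> nat \<Rightarrow> 'a \<Rightarrow> real" where
  "factor \<alpha> s0 s t \<omega> = exp (lam \<alpha> s0 k (h \<omega>) t * (s * (xi k (h \<omega>) t - \<theta> / (k t + 1)))
     - psiE (lam \<alpha> s0 k (h \<omega>) t) * (xi k (h \<omega>) t - xihat k (h \<omega>) t)\<^sup>2)"

definition wealth :: "real \<Rightarrow> real \<Rightarrow> real \<Rightarrow> nat \<Rightarrow> 'a \<Rightarrow> real" where
  "wealth \<alpha> s0 s n \<omega> = (\<Prod>t=1..n. factor \<alpha> s0 s t \<omega>)"

lemma factor_measurable:
  assumes "1 \<le> i" "i < t"
  shows "factor \<alpha> s0 s i \<in> borel_measurable (H t)"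
proof -
  have sub: "subalgebra (H t) (H i)"
    using hist_mono[of i t] assms by (simp add: subalgebra_def spaces)
  note [measurable] = xi_measurable[OF assms] measurable_from_subalg[OF sub xihat_measurable]
    measurable_from_subalg[OF sub lam_measurable[OF assms(1)]]
  show ?thesis unfolding factor_def[abs_def] by measurable
qed

lemma wealth_measurable: "wealth \<alpha> s0 s n \<in> borel_measurable (H (Suc n))"
  unfolding wealth_def[abs_def] by (intro borel_measurable_prod factor_measurable) auto

section \<open>The supermartingale property of the wealth\<close>

context
  fixes \<alpha> s0 s :: real
  assumes \<alpha>: "0 < \<alpha>" "\<alpha> < 1" and s0: "0 < s0" and s: "\<bar>s\<bar> = 1"
begin

definition gain :: "nat \<Rightarrow> 'a \<Rightarrow> real" where
  "gain t \<omega> = tangent_slope (lam \<alpha> s0 k (h \<omega>) t) (s * (xihat k (h \<omega>) t - \<theta> / (k t + 1)))"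

lemma factor_le_linear:
  assumes "1 \<le> t" "\<omega> \<in> space M"
  shows "factor \<alpha> s0 s t \<omega> \<le> 1 + gain t \<omega> * (s * (xi k (h \<omega>) t - \<theta> / (k t + 1)))"
proof -
  let ?m = "\<theta> / (k t + 1)" and ?l = "lam \<alpha> s0 k (h \<omega>) t"
  let ?y = "s * (xi k (h \<omega>) t - ?m)" and ?d = "s * (xihat k (h \<omega>) t - ?m)"
  have "(?y - ?d)\<^sup>2 = \<bar>s\<bar>\<^sup>2 * (xi k (h \<omega>) t - xihat k (h \<omega>) t)\<^sup>2"
    by (simp add: power2_eq_square algebra_simps)
  then have "(xi k (h \<omega>) t - xihat k (h \<omega>) t)\<^sup>2 = (?y - ?d)\<^sup>2" by (simp add: s)
  then have "factor \<alpha> s0 s t \<omega> = exp (?l * ?y - psiE ?l * (?y - ?d)\<^sup>2)"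
    unfolding factor_def by simp
  also have "\<dots> \<le> 1 + tangent_slope ?l ?d * ?y"
    using lam_bounds[OF \<alpha> s0 assms(1), of k "h \<omega>"] xi_centered[OF assms] s
    by (intro exp_le_linear) (auto simp: abs_mult)
  finally show ?thesis by (simp add: gain_def)
qed

lemma gain_bounds:
  assumes "1 \<le> t"
  shows "0 \<le> gain t \<omega>" "gain t \<omega> \<le> 1"
  using tangent_slope_bounds lam_bounds[OF \<alpha> s0 assms, of k "h \<omega>"] by (auto simp: gain_def)

text \<open>Slope and deviation are both at most 1 in absolute value, so the linear bound is at most
  2. This keeps the wealth at any fixed time bounded and hence integrable.\<close>

lemma factor_bounds:
  assumes "1 \<le> t" "\<omega> \<in> space M"
  shows "0 \<le> factor \<alpha> s0 s t \<omega>" "factor \<alpha> s0 s t \<omega> \<le> 2"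
proof -
  have "\<bar>gain t \<omega> * (s * (xi k (h \<omega>) t - \<theta> / (k t + 1)))\<bar> \<le> 1 * (1 * 1)"
    unfolding abs_mult using gain_bounds[OF assms(1), of \<omega>] xi_centered[OF assms] s
    by (intro mult_mono) auto
  then show "factor \<alpha> s0 s t \<omega> \<le> 2" using factor_le_linear[OF assms] by linarith
qed (simp add: factor_def)

lemma wealth_bounds:
  assumes "\<omega> \<in> space M"
  shows "0 \<le> wealth \<alpha> s0 s n \<omega>" "wealth \<alpha> s0 s n \<omega> \<le> 2 ^ n"
proof -
  show "0 \<le> wealth \<alpha> s0 s n \<omega>"
    unfolding wealth_def using factor_bounds assms by (intro prod_nonneg) auto
  have "wealth \<alpha> s0 s n \<omega> \<le> (\<Prod>t=1..n. 2)"
    unfolding wealth_def using factor_bounds assms by (intro prod_mono) auto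
  then show "wealth \<alpha> s0 s n \<omega> \<le> 2 ^ n" by simp
qed

text \<open>One supermartingale step in integrated form. The linear bound leaves \<open>G\<close>
  plus a multiple of the centred score weighted by \<open>G'\<close>; as \<open>G'\<close> is
  bounded and known from the past, \<open>expectation_hseq\<close> makes that term vanish.\<close>

lemma expectation_mult_factor:
  assumes t: "1 \<le> t" and G: "G \<in> borel_measurable (H t)"
    and B: "\<And>\<omega>. \<omega> \<in> space M \<Longrightarrow> 0 \<le> G \<omega> \<and> G \<omega> \<le> B"
  shows "expectation (\<lambda>\<omega>. G \<omega> * factor \<alpha> s0 s t \<omega>) \<le> expectation G"
proof -
  note [measurable] = lam_measurable[OF t] xihat_measurable[of t] G
  have gain [measurable]: "gain t \<in> borel_measurable (H t)"
    unfolding gain_def[abs_def] by measurable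
  define G' where "G' \<omega> = G \<omega> * gain t \<omega>" for \<omega>
  have G' [measurable]: "G' \<in> borel_measurable (H t)"
    unfolding G'_def[abs_def] by measurable
  note [measurable] = measurable_from_subalg[OF subalgebra_hist G']
    measurable_from_subalg[OF subalgebra_hist G]
    measurable_from_subalg[OF subalgebra_hist hseq_measurable[OF t, of "Suc t", simplified]]
    measurable_from_subalg[OF subalgebra_hist factor_measurable[OF t, of "Suc t", simplified]]
  have G'_bound: "\<bar>G' \<omega>\<bar> \<le> B" if "\<omega> \<in> space M" for \<omega>
  proof -
    have "\<bar>G \<omega>\<bar> * \<bar>gain t \<omega>\<bar> \<le> B * 1"
      using B[OF that] gain_bounds[OF t, of \<omega>] by (intro mult_mono) auto
    then show ?thesis by (simp add: G'_def abs_mult)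
  qed
  have iG: "integrable M G" using B by (intro integrable_bounded[of _ B]) auto
  have iG': "integrable M G'" using G'_bound by (intro integrable_bounded[of _ B]) auto
  have iGh: "integrable M (\<lambda>\<omega>. G' \<omega> * h \<omega> t)"
  proof (rule integrable_bounded)
    show "\<bar>G' \<omega> * h \<omega> t\<bar> \<le> B * k t" if "\<omega> \<in> space M" for \<omega>
      unfolding abs_mult using G'_bound[OF that] hseq_bound[OF t that] by (intro mult_mono) auto
  qed measurable
  have ie: "integrable M (\<lambda>\<omega>. G \<omega> * factor \<alpha> s0 s t \<omega>)"
  proof (rule integrable_bounded)
    show "\<bar>G \<omega> * factor \<alpha> s0 s t \<omega>\<bar> \<le> B * 2" if "\<omega> \<in> space M" for \<omega>
      unfolding abs_mult using B[OF that] factor_bounds[OF t that] by (intro mult_mono) auto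
  qed measurable
  let ?c = "s / (k t + 1)"
  have iR: "integrable M (\<lambda>\<omega>. ?c * (G' \<omega> * h \<omega> t - \<theta> * G' \<omega>))"
    using iG' iGh by (intro integrable_mult_right Bochner_Integration.integrable_diff)
  have "expectation (\<lambda>\<omega>. G \<omega> * factor \<alpha> s0 s t \<omega>) \<le>
      expectation (\<lambda>\<omega>. G \<omega> + ?c * (G' \<omega> * h \<omega> t - \<theta> * G' \<omega>))"
  proof (intro integral_mono ie Bochner_Integration.integrable_add iG iR)
    fix \<omega> assume \<omega>: "\<omega> \<in> space M"
    have "G \<omega> * factor \<alpha> s0 s t \<omega> \<le>
        G \<omega> * (1 + gain t \<omega> * (s * (xi k (h \<omega>) t - \<theta> / (k t + 1))))"
      using B[OF \<omega>] factor_le_linear[OF t \<omega>] by (intro mult_left_mono) auto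
    also have "xi k (h \<omega>) t - \<theta> / (k t + 1) = (h \<omega> t - \<theta>) / (k t + 1)"
      by (simp add: xi_def diff_divide_distrib)
    also have "G \<omega> * (1 + gain t \<omega> * (s * ((h \<omega> t - \<theta>) / (k t + 1)))) =
        G \<omega> + ?c * (G' \<omega> * h \<omega> t - \<theta> * G' \<omega>)"
      by (simp add: G'_def divide_inverse algebra_simps)
    finally show "G \<omega> * factor \<alpha> s0 s t \<omega> \<le> G \<omega> + ?c * (G' \<omega> * h \<omega> t - \<theta> * G' \<omega>)" .
  qed
  also have "\<dots> = expectation G + ?c * (expectation (\<lambda>\<omega>. G' \<omega> * h \<omega> t) - \<theta> * expectation G')"
    using iG iG' iGh iR by simp
  also have "\<dots> = expectation G"
    using expectation_hseq[OF t G' G'_bound] by simp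
  finally show ?thesis .
qed

lemma wealth_exceeds:
  "prob {\<omega>\<in>space M. \<exists>n. 2 / \<alpha> \<le> wealth \<alpha> s0 s n \<omega>} \<le> \<alpha> / 2"
proof -
  have wm: "wealth \<alpha> s0 s n \<in> borel_measurable M" for n
    by (rule measurable_from_subalg[OF subalgebra_hist wealth_measurable])
  have "prob {\<omega>\<in>space M. \<exists>n. 2 / \<alpha> \<le> wealth \<alpha> s0 s n \<omega>} \<le>
      expectation (wealth \<alpha> s0 s 0) / (2 / \<alpha>)"
  \<comment> \<open>The index is shifted because the wealth after \<open>n\<close> rounds is known
    from \<open>H (Suc n)\<close>, the past before round \<open>n + 1\<close>.\<close>
  proof (rule supermartingale_maximal[where F = "\<lambda>n. H (Suc n)"])
    fix n S assume S: "S \<in> sets (H (Suc n))"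
    \<comment> \<open>Absorbing the indicator of \<open>S\<close> into \<open>G\<close> turns the
      inequality of set integrals into \<open>expectation_mult_factor\<close>.\<close>
    define G where "G \<omega> = indicator S \<omega> * wealth \<alpha> s0 s n \<omega>" for \<omega>
    have G: "G \<in> borel_measurable (H (Suc n))"
      unfolding G_def[abs_def] using S wealth_measurable by measurable
    have "expectation (\<lambda>\<omega>. G \<omega> * factor \<alpha> s0 s (Suc n) \<omega>) \<le> expectation G"
      by (rule expectation_mult_factor[OF _ G, of "2 ^ n"])
        (auto simp: G_def indicator_def wealth_bounds)
    then show "(\<integral>\<omega>\<in>S. wealth \<alpha> s0 s (Suc n) \<omega> \<partial>M) \<le> (\<integral>\<omega>\<in>S. wealth \<alpha> s0 s n \<omega> \<partial>M)"
      by (simp add: set_lebesgue_integral_def G_def[abs_def] wealth_def mult.assoc)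
  next
    show "integrable M (wealth \<alpha> s0 s n)" for n
      using wealth_bounds wm by (intro integrable_bounded[of _ "2 ^ n"]) auto
  qed (use \<alpha> in \<open>auto simp: subalgebra_hist wealth_measurable wealth_bounds hist_mono subsetD\<close>)
  moreover have "wealth \<alpha> s0 s 0 = (\<lambda>_. 1)" by (simp add: fun_eq_iff wealth_def)
  ultimately show ?thesis by (simp add: prob_space)
qed

end

section \<open>From large wealth to coverage\<close>

lemma not_in_CS_imp_wealth:
  assumes \<alpha>: "0 < \<alpha>" "\<alpha> < 1" and s0: "0 < s0" and T: "1 \<le> T"
    and out: "\<theta> \<notin> CS_PrPI_EB \<alpha> s0 k (h \<omega>) T"
  shows "2 / \<alpha> \<le> wealth \<alpha> s0 1 T \<omega> \<or> 2 / \<alpha> \<le> wealth \<alpha> s0 (-1) T \<omega>"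
proof -
  define l where "l t = lam \<alpha> s0 k (h \<omega>) t" for t
  define x where "x t = xi k (h \<omega>) t" for t
  define D where "D = (\<Sum>t=1..T. l t / (k t + 1))"
  define N where "N = (\<Sum>t=1..T. l t * x t)"
  define V where "V = (\<Sum>t=1..T. (x t - xihat k (h \<omega>) t)\<^sup>2 * psiE (l t))"
  have D: "0 < D"
    unfolding D_def
  proof (rule sum_pos)
    fix t assume "t \<in> {1..T}"
    then show "0 < l t / (k t + 1)"
      using lam_bounds(1)[OF \<alpha> s0, of t k "h \<omega>"] k_ge[of t] by (simp add: l_def)
  qed (use T in auto)
  \<comment> \<open>The logarithm of the wealth is affine in \<open>\<theta>\<close>, built from the
    sums that define centre and radius. If the interval misses \<open>\<theta>\<close> on one side,
    the logarithm for the matching sign exceeds \<open>ln (2 / \<alpha>)\<close>.\<close>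
  have wealth: "wealth \<alpha> s0 s T \<omega> = exp (s * (N - \<theta> * D) - V)" for s
  proof -
    have "wealth \<alpha> s0 s T \<omega> =
        exp (\<Sum>t=1..T. l t * (s * (x t - \<theta> / (k t + 1))) - psiE (l t) * (x t - xihat k (h \<omega>) t)\<^sup>2)"
      by (simp add: wealth_def factor_def exp_sum l_def x_def)
    also have "(\<Sum>t=1..T. l t * (s * (x t - \<theta> / (k t + 1))) - psiE (l t) * (x t - xihat k (h \<omega>) t)\<^sup>2)
        = s * (N - \<theta> * D) - V"
      unfolding N_def D_def V_def sum_distrib_left sum_subtractf[symmetric]
      by (intro sum.cong refl) (simp add: algebra_simps)
    finally show ?thesis .
  qed
  have *: "2 / \<alpha> \<le> wealth \<alpha> s0 s T \<omega>" if "ln (2 / \<alpha>) + V < s * (N - \<theta> * D)" for s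
  proof -
    have "2 / \<alpha> = exp (ln (2 / \<alpha>))" using \<alpha> by simp
    also have "\<dots> \<le> exp (s * (N - \<theta> * D) - V)" using that by simp
    finally show ?thesis by (simp add: wealth)
  qed
  have "CS_PrPI_EB \<alpha> s0 k (h \<omega>) T =
      {N / D - (ln (2 / \<alpha>) + V) / D .. N / D + (ln (2 / \<alpha>) + V) / D}"
    by (simp add: CS_PrPI_EB_def cs_center_def cs_radius_def N_def D_def V_def l_def x_def)
  then have "\<theta> < N / D - (ln (2 / \<alpha>) + V) / D \<or> N / D + (ln (2 / \<alpha>) + V) / D < \<theta>"
    using out by auto
  then have "\<theta> * D < N - (ln (2 / \<alpha>) + V) \<or> N + (ln (2 / \<alpha>) + V) < \<theta> * D"
    using D by (simp add: less_divide_eq divide_less_eq flip: diff_divide_distrib add_divide_distrib)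
  then show ?thesis
  proof
    assume "\<theta> * D < N - (ln (2 / \<alpha>) + V)"
    then show ?thesis by (intro disjI1 *) simp
  next
    assume "N + (ln (2 / \<alpha>) + V) < \<theta> * D"
    then show ?thesis by (intro disjI2 *) simp
  qed
qed

text \<open>A union bound over the two signs, each contributing at most \<open>\<alpha> / 2\<close>;
  one crossing event per sign covers all \<open>T\<close> at once.\<close>

lemma coverage:
  assumes \<alpha>: "0 < \<alpha>" "\<alpha> < 1" and s0: "0 < s0"
  shows "1 - \<alpha> \<le> prob {\<omega>\<in>space M. \<forall>T\<ge>1. \<theta> \<in> CS_PrPI_EB \<alpha> s0 k (h \<omega>) T}"
proof -
  have xi_M: "(\<lambda>\<omega>. xi k (h \<omega>) t) \<in> borel_measurable M" if "1 \<le> t" for t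
    using measurable_from_subalg[OF subalgebra_hist xi_measurable[of t "Suc t"]] that by simp
  have lam_M: "(\<lambda>\<omega>. lam \<alpha> s0 k (h \<omega>) t) \<in> borel_measurable M" if "1 \<le> t" for t
    using measurable_from_subalg[OF subalgebra_hist lam_measurable[of t]] that by simp
  have xihat_M: "(\<lambda>\<omega>. xihat k (h \<omega>) t) \<in> borel_measurable M" for t
    by (rule measurable_from_subalg[OF subalgebra_hist xihat_measurable])
  have psi_M: "(\<lambda>\<omega>. psiE (lam \<alpha> s0 k (h \<omega>) t)) \<in> borel_measurable M" if "1 \<le> t" for t
    using measurable_compose[OF lam_M[OF that] psiE_measurable] by simp
  have [measurable]: "(\<lambda>\<omega>. cs_center \<alpha> s0 k (h \<omega>) T) \<in> borel_measurable M" for T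
    unfolding cs_center_def
    by (intro borel_measurable_divide borel_measurable_sum borel_measurable_times xi_M lam_M
        borel_measurable_const) auto
  have [measurable]: "(\<lambda>\<omega>. cs_radius \<alpha> s0 k (h \<omega>) T) \<in> borel_measurable M" for T
    unfolding cs_radius_def
    by (intro borel_measurable_divide borel_measurable_add borel_measurable_sum
        borel_measurable_times borel_measurable_power borel_measurable_diff xi_M lam_M xihat_M psi_M
        borel_measurable_const) auto
  have good: "{\<omega>\<in>space M. \<forall>T\<ge>1. \<theta> \<in> CS_PrPI_EB \<alpha> s0 k (h \<omega>) T} \<in> events"
    unfolding CS_PrPI_EB_def atLeastAtMost_iff by measurable
  define E where "E s = {\<omega>\<in>space M. \<exists>n. 2 / \<alpha> \<le> wealth \<alpha> s0 s n \<omega>}" for s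
  have [measurable]: "wealth \<alpha> s0 s n \<in> borel_measurable M" for s n
    by (rule measurable_from_subalg[OF subalgebra_hist wealth_measurable])
  have E: "E s \<in> events" for s unfolding E_def by measurable
  have "1 - prob {\<omega>\<in>space M. \<forall>T\<ge>1. \<theta> \<in> CS_PrPI_EB \<alpha> s0 k (h \<omega>) T} =
      prob (space M - {\<omega>\<in>space M. \<forall>T\<ge>1. \<theta> \<in> CS_PrPI_EB \<alpha> s0 k (h \<omega>) T})"
    by (rule prob_compl[OF good, symmetric])
  also have "\<dots> \<le> prob (E 1 \<union> E (-1))"
    using not_in_CS_imp_wealth[OF assms] E by (intro finite_measure_mono) (auto simp: E_def)
  also have "\<dots> \<le> prob (E 1) + prob (E (-1))" by (rule measure_Un_le[OF E E])
  also have "\<dots> \<le> \<alpha>"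
    using wealth_exceeds[OF assms, of 1] wealth_exceeds[OF assms, of "-1"] by (simp add: E_def)
  finally show ?thesis by simp
qed

end

theorem theorem3:
  fixes M :: "'a measure" and Mx :: "'x measure"
    and X :: "nat \<Rightarrow> 'a \<Rightarrow> 'x" and A :: "nat \<Rightarrow> 'a \<Rightarrow> bool"
    and Y0 Y1 :: "nat \<Rightarrow> 'a \<Rightarrow> real"
    and p :: "nat \<Rightarrow> 'a \<Rightarrow> real"
    and fhat :: "nat \<Rightarrow> bool \<Rightarrow> 'x \<Rightarrow> 'a \<Rightarrow> real"
    and k :: "nat \<Rightarrow> real" and \<alpha> \<sigma>0sq :: real
  assumes prob: "prob_space M"
    and X_meas: "\<And>t. X t \<in> measurable M Mx"
    and A_meas: "\<And>t. A t \<in> measurable M (count_space UNIV)"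
    and Y0_meas: "\<And>t. Y0 t \<in> borel_measurable M"
    and Y1_meas: "\<And>t. Y1 t \<in> borel_measurable M"
    and Y_bounds: "\<And>t \<omega>. t \<ge> 1 \<Longrightarrow> \<omega> \<in> space M \<Longrightarrow>
                     Y0 t \<omega> \<in> {0..1} \<and> Y1 t \<omega> \<in> {0..1}"
    \<comment> \<open>the tuples (X_t, Y_t(0), Y_t(1)), t \<ge> 1, are i.i.d.\<close>
    and iid_indep: "prob_space.indep_vars M (\<lambda>_. Mx \<Otimes>\<^sub>M borel \<Otimes>\<^sub>M borel)
                      (\<lambda>t \<omega>. (X t \<omega>, Y0 t \<omega>, Y1 t \<omega>)) {1..}"
    and iid_distr: "\<And>t. t \<ge> 1 \<Longrightarrow>
                      distr M (Mx \<Otimes>\<^sub>M borel \<Otimes>\<^sub>M borel) (\<lambda>\<omega>. (X t \<omega>, Y0 t \<omega>, Y1 t \<omega>))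
                    = distr M (Mx \<Otimes>\<^sub>M borel \<Otimes>\<^sub>M borel) (\<lambda>\<omega>. (X 1 \<omega>, Y0 1 \<omega>, Y1 1 \<omega>))"
    \<comment> \<open>sequential arrival: the new tuple is independent of the past history Omega_{t-1}\<close>
    and fresh: "\<And>t. t \<ge> 1 \<Longrightarrow> prob_space.indep_set M
                  (sigma_sets (space M) (pre_sets M (Mx \<Otimes>\<^sub>M borel \<Otimes>\<^sub>M borel)
                      (\<lambda>\<omega>. (X t \<omega>, Y0 t \<omega>, Y1 t \<omega>))))
                  (sets (hist M Mx X A Y0 Y1 t))"
    \<comment> \<open>propensity score pi_t(1 | X_t, Omega_{t-1})\<close>
    and p_meas: "\<And>t. t \<ge> 1 \<Longrightarrow> p t \<in> borel_measurable (histX M Mx X A Y0 Y1 t)"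
    and p_cond: "\<And>t. t \<ge> 1 \<Longrightarrow>
                  AE \<omega> in M. real_cond_exp M (histXY M Mx X A Y0 Y1 t)
                      (\<lambda>\<omega>. indicator {\<omega>. A t \<omega>} \<omega>) \<omega> = p t \<omega>"
    \<comment> \<open>truncation\<close>
    and k_ge: "\<And>t. t \<ge> 1 \<Longrightarrow> k t \<ge> 2"
    and p_trunc: "\<And>t \<omega>. t \<ge> 1 \<Longrightarrow> \<omega> \<in> space M \<Longrightarrow>
                    1 / k t \<le> p t \<omega> \<and> p t \<omega> \<le> 1 - 1 / k t"
    \<comment> \<open>outcome-model estimators fhat_t, built from Omega_t, with values in [0,1]\<close>
    and fhat_meas: "\<And>t a. (\<lambda>(x, \<omega>). fhat t a x \<omega>)
                      \<in> borel_measurable (Mx \<Otimes>\<^sub>M hist M Mx X A Y0 Y1 (Suc t))"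
    and fhat_bounds: "\<And>t a x \<omega>. fhat t a x \<omega> \<in> {0..1}"
    and alpha: "0 < \<alpha>" "\<alpha> < 1"
    and sigma0: "\<sigma>0sq > 0"
  shows "measure M {\<omega> \<in> space M. \<forall>T\<ge>1.
            prob_space.expectation M (\<lambda>\<omega>. Y1 1 \<omega> - Y0 1 \<omega>)
              \<in> CS_PrPI_EB \<alpha> \<sigma>0sq k (\<lambda>t. hseq X A Y0 Y1 p fhat t \<omega>) T}
         \<ge> 1 - \<alpha>"
proof -
  interpret prob_space M by (rule prob)
  interpret adaptive_experiment M Mx X A Y0 Y1 p fhat k
    using X_meas A_meas Y0_meas Y1_meas Y_bounds iid_distr fresh p_meas p_cond
      k_ge p_trunc fhat_meas fhat_bounds
    by (intro adaptive_experiment.intro[OF prob] adaptive_experiment_axioms.intro)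
  show ?thesis by (rule coverage[OF alpha sigma0, unfolded \<theta>_def])
qed

end
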